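(* Let $n$ be a positive integer. For any group $G$, $\mathcal{D}(G\wr S_n)$ is a subalgebra of $\mathbb{Z}[G\wr S_n]$ and is anti-isomorphic to $(\mathbb{Z}\Sigma_n^G)^{S_n}$.
   Context: Let $e$ be the identity of $G$ and $[n]=\{1,\dots,n\}$. **The semigroup $\Sigma_n^G$.** An ordered partition of $[n]$ is a tuple $(B_1,\dots,B_k)$ of nonempty pairwise disjoint sets with union $[n]$. An ordered $G$-partition of $[n]$ is a tuple $((B_1,g_1),\dots,(B_k,g_k))$ such that $(B_1,\dots,B_k)$ is an ordered partition of $[n]$ and $g_i\in G$ for all $i$. $\Sigma_n^G$ is the set of ordered $G$-partitions of $[n]$, with the product of $((B_1,g_1),\dots,(B_k,g_k))$ and $((C_1,h_1),\dots,(C_\ell,h_\ell))$ (in this order) being the tuple of pairs $(B_i\cap C_j,\,h_jg_i)$, listed in lexicographic order of $(i,j)\in[k]\times[\ell]$ (all $j$ for $i=1$ first, then all $j$ for $i=2$, etc.), with pairs for which $B_i\cap C_j=\emptyset$ omitted. This makes $\Sigma_n^G$ a semigroup with identity $(([n],e))$. $\mathbb{Z}\Sigma_n^G$ is its semigroup algebra over $\mathbb{Z}$. **The invariant subalgebra.** The symmetric group $S_n$ acts on $\Sigma_n^G$ by $\pi\cdot((B_1,g_1),\dots,(B_k,g_k))=((\pi(B_1),g_1),\dots,(\pi(B_k),g_k))$, extended linearly to $\mathbb{Z}\Sigma_n^G$; $(\mathbb{Z}\Sigma_n^G)^{S_n}$ is the subalgebra of elements $P$ with $\pi\cdot P=P$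 for all $\pi\in S_n$. **The wreath product.** $G\wr S_n$ is the set $S_n\times G^{[n]}$, where $G^{[n]}$ is the set of functions $[n]\to G$; $(\pi,g)$ is written $((\pi_1,g_1),\dots,(\pi_n,g_n))$ with $\pi_i=\pi(i)$, $g_i=g(i)$. The group operation is $$((\pi_1,g_1),\dots,(\pi_n,g_n))*((\tau_1,h_1),\dots,(\tau_n,h_n))=((\pi_{\tau_1},g_{\tau_1}h_1),\dots,(\pi_{\tau_n},g_{\tau_n}h_n)).$$ $\mathbb{Z}[G\wr S_n]$ is its group algebra over $\mathbb{Z}$. **The module $\mathcal{D}(G\wr S_n)$.** A $G$-composition of $n$ is a sequence $((a_1,g_1),\dots,(a_k,g_k))$ with $a_i$ positive integers summing to $n$ and $g_i\in G$. For $u=((\pi_1,g_1),\dots,(\pi_n,g_n))\in G\wr S_n$, $\mathrm{Co}(u)$ is the unique $G$-composition $((a_1,h_1),\dots,(a_k,h_k))$ of $n$ with $k$ as small as possible such that, for each $r\in[k]$, writing $s_r=a_1+\cdots+a_{r-1}$ (so $s_1=0$), one has $\pi_{s_r+1}<\pi_{s_r+2}<\cdots<\pi_{s_r+a_r}$ and $g_{s_r+1}=\cdots=g_{s_r+a_r}=h_r$. For a $G$-composition $\alpha$ of $n$, $Y_\alpha=\sum u\in\mathbb{Z}[G\wr S_n]$, the sum over all $u\in G\wr S_n$ with $\mathrm{Co}(u)=\alpha$ (a finite sum). $\mathcal{D}(G\wr S_n)$ is the $\mathbb{Z}$-linear span of all $Y_\alpha$, $\alpha$ ranging over the $G$-compositions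 of $n$. Two algebras $A,B$ are anti-isomorphic if there is a bijective $\mathbb{Z}$-linear map $f:A\to B$ with $f(xy)=f(y)f(x)$ for all $x,y\in A$. *)

theory Defs
  imports "HOL-Library.Poly_Mapping" "HOL-Library.Disjoint_Sets" "HOL-Algebra.Algebra"
begin

section \<open>Semigroup algebras over the integers\<close>

text \<open>
  Elements are finitely supported integer-valued functions with support in the monoid;
  the product is the bilinear extension of the product of the monoid. The result is a
  \<^type>\<open>module\<close> record, that is, a ring record with a scalar multiplication. The library
  locale \<^locale>\<open>algebra\<close> is not used, as it demands a commutative product.
\<close>

definition semigroup_algebra :: "('a, 'm) monoid_scheme \<Rightarrow> (int, 'a \<Rightarrow>\<^sub>0 int) module" where
  "semigroup_algebra M =
     \<lparr>carrier = {x. Poly_Mapping.keys x \<subseteq> carrier M},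
      monoid.mult = (\<lambda>x y. frag_extend (\<lambda>a. frag_extend (\<lambda>b. frag_of (a \<otimes>\<^bsub>M\<^esub> b)) y) x),
      one = frag_of \<one>\<^bsub>M\<^esub>,
      ring.zero = 0,
      ring.add = (+),
      module.smult = frag_cmul\<rparr>"

definition subalgebra_over :: "('r, 'k) ring_scheme \<Rightarrow> 'a set \<Rightarrow> ('r, 'a, 'l) module_scheme \<Rightarrow> bool" where
  "subalgebra_over R S A \<longleftrightarrow> submodule S R A \<and> subring S A"

definition anti_isomorphic ::
  "('r, 'k) ring_scheme \<Rightarrow> ('r, 'a, 'l) module_scheme \<Rightarrow> ('r, 'b, 'm) module_scheme \<Rightarrow> bool" where
  "anti_isomorphic R A B \<longleftrightarrow>
     (\<exists>f. bij_betw f (carrier A) (carrier B) \<and>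
          (\<forall>x\<in>carrier A. \<forall>y\<in>carrier A. f (x \<oplus>\<^bsub>A\<^esub> y) = f x \<oplus>\<^bsub>B\<^esub> f y) \<and>
          (\<forall>k\<in>carrier R. \<forall>x\<in>carrier A. f (k \<odot>\<^bsub>A\<^esub> x) = k \<odot>\<^bsub>B\<^esub> f x) \<and>
          (\<forall>x\<in>carrier A. \<forall>y\<in>carrier A. f (x \<otimes>\<^bsub>A\<^esub> y) = f y \<otimes>\<^bsub>B\<^esub> f x))"


section \<open>Ordered \<open>G\<close>-partitions\<close>

definition ordered_partition :: "nat \<Rightarrow> nat set list \<Rightarrow> bool" where
  "ordered_partition n Bs \<longleftrightarrow> distinct Bs \<and> partition_on {1..n} (set Bs)"

definition ordered_G_partition :: "('g, 'm) monoid_scheme \<Rightarrow> nat \<Rightarrow> (nat set \<times> 'g) list \<Rightarrow> bool" where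
  "ordered_G_partition G n P \<longleftrightarrow>
     ordered_partition n (map fst P) \<and> set (map snd P) \<subseteq> carrier G"

text \<open>Note the order of the factors: the group entry of \<open>B \<inter> C\<close> is \<open>h \<otimes> g\<close>.\<close>

definition G_partition_monoid :: "('g, 'm) monoid_scheme \<Rightarrow> nat \<Rightarrow> (nat set \<times> 'g) list monoid" where
  "G_partition_monoid G n =
     \<lparr>carrier = {P. ordered_G_partition G n P},
      monoid.mult = (\<lambda>P Q. [(B \<inter> C, h \<otimes>\<^bsub>G\<^esub> g). (B, g) \<leftarrow> P, (C, h) \<leftarrow> Q, B \<inter> C \<noteq> {}]),
      one = [({1..n}, \<one>\<^bsub>G\<^esub>)]\<rparr>"

definition perm_act :: "(nat \<Rightarrow> nat) \<Rightarrow> (nat set \<times> 'g) list \<Rightarrow> (nat set \<times> 'g) list" where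
  "perm_act \<pi> P = map (\<lambda>(B, g). (\<pi> ` B, g)) P"

definition invariant_algebra ::
  "('g, 'm) monoid_scheme \<Rightarrow> nat \<Rightarrow> (int, (nat set \<times> 'g) list \<Rightarrow>\<^sub>0 int) module" where
  "invariant_algebra G n =
     (semigroup_algebra (G_partition_monoid G n))
       \<lparr>carrier := {x \<in> carrier (semigroup_algebra (G_partition_monoid G n)).
          \<forall>\<pi>\<in>carrier (sym_group n). frag_extend (\<lambda>P. frag_of (perm_act \<pi> P)) x = x}\<rparr>"


section \<open>The wreath product and the module spanned by the \<open>Y\<close>\<close>

definition wreath_product ::
  "('g, 'm) monoid_scheme \<Rightarrow> nat \<Rightarrow> ((nat \<Rightarrow> nat) \<times> (nat \<Rightarrow> 'g)) monoid" where
  "wreath_product G n =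
     \<lparr>carrier = carrier (sym_group n) \<times> ({1..n} \<rightarrow>\<^sub>E carrier G),
      monoid.mult = (\<lambda>(\<pi>, g) (\<tau>, h). (\<pi> \<circ> \<tau>, \<lambda>i\<in>{1..n}. g (\<tau> i) \<otimes>\<^bsub>G\<^esub> h i)),
      one = (id, \<lambda>i\<in>{1..n}. \<one>\<^bsub>G\<^esub>)\<rparr>"

definition G_composition :: "('g, 'm) monoid_scheme \<Rightarrow> nat \<Rightarrow> (nat \<times> 'g) list \<Rightarrow> bool" where
  "G_composition G n \<alpha> \<longleftrightarrow>
     (\<forall>(a, g)\<in>set \<alpha>. 0 < a \<and> g \<in> carrier G) \<and> sum_list (map fst \<alpha>) = n"

text \<open>
  The blocks of \<open>\<alpha>\<close> are indexed from \<open>0\<close>, so \<open>s\<close> is the sum of the first \<open>r\<close> parts and the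
  block with index \<open>r\<close> occupies the positions \<open>s + 1, \<dots>, s + a\<close>.
\<close>

definition block_condition :: "(nat \<Rightarrow> nat) \<times> (nat \<Rightarrow> 'g) \<Rightarrow> (nat \<times> 'g) list \<Rightarrow> bool" where
  "block_condition u \<alpha> \<longleftrightarrow>
     (\<forall>r<length \<alpha>.
        let s = sum_list (map fst (take r \<alpha>)); (a, h) = \<alpha> ! r
        in strict_mono_on {s + 1..s + a} (fst u) \<and> (\<forall>i\<in>{s + 1..s + a}. snd u i = h))"

definition Co ::
  "('g, 'm) monoid_scheme \<Rightarrow> nat \<Rightarrow> (nat \<Rightarrow> nat) \<times> (nat \<Rightarrow> 'g) \<Rightarrow> (nat \<times> 'g) list" where
  "Co G n u = (THE \<alpha>. is_arg_min length (\<lambda>\<beta>. G_composition G n \<beta> \<and> block_condition u \<beta>) \<alpha>)"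

definition Y ::
  "('g, 'm) monoid_scheme \<Rightarrow> nat \<Rightarrow> (nat \<times> 'g) list \<Rightarrow> ((nat \<Rightarrow> nat) \<times> (nat \<Rightarrow> 'g)) \<Rightarrow>\<^sub>0 int" where
  "Y G n \<alpha> = (\<Sum>u | u \<in> carrier (wreath_product G n) \<and> Co G n u = \<alpha>. frag_of u)"

definition descent_module ::
  "('g, 'm) monoid_scheme \<Rightarrow> nat \<Rightarrow> (((nat \<Rightarrow> nat) \<times> (nat \<Rightarrow> 'g)) \<Rightarrow>\<^sub>0 int) set" where
  "descent_module G n = Modules.module.span frag_cmul {Y G n \<alpha> |\<alpha>. G_composition G n \<alpha>}"

text \<open>The library span is only meaningful once its scalar multiplication is known to be a module.\<close>

lemma module_frag_cmul: "Modules.module (frag_cmul :: int \<Rightarrow> ('a \<Rightarrow>\<^sub>0 int) \<Rightarrow> ('a \<Rightarrow>\<^sub>0 int))"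
  by unfold_locales (simp_all add: frag_cmul_distrib frag_cmul_distrib2)

end

theory Submission
  imports Defs
begin

text \<open>
  Multiplying an ordered \<open>G\<close>-partition \<open>P\<close> from the right by the partition of \<open>{1..n}\<close> into
  singletons, in their natural order and with neutral colours, breaks the blocks of \<open>P\<close> up into
  their elements. The result is a word of distinct coloured letters, that is, an element \<open>\<phi> P\<close> of
  the wreath product. The linear extension \<open>F\<close> of \<open>\<phi>\<close>, restricted to the invariants of the
  symmetric group, turns out to be an anti-isomorphism onto the module spanned by the \<open>Y\<close>. So this
  module is closed under multiplication, as the image of an algebra, and the inverse of \<open>F\<close> is the
  required map.

  The map reverses products because \<open>\<phi> (P Q) = \<phi> Q * \<phi> (\<tau>\<^sup>-\<^sup>1 P)\<close>, where \<open>\<tau>\<close> is the permutation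
  that underlies \<open>\<phi> Q\<close> (\<open>listing_mult_eq_word\<close>): the product sorts the word of \<open>Q\<close> by the blocks of
  \<open>P\<close>, and renaming the letters by \<open>\<tau>\<^sup>-\<^sup>1\<close> reduces this to sorting the identity word. When \<open>P\<close>
  is replaced by an invariant element, the translation by \<open>\<tau>\<^sup>-\<^sup>1\<close> has no effect
  (\<open>arrange_mult\<close>).

  Bijectivity is a triangularity argument. The orbits of the symmetric group correspond to the
  shapes, that is, to the \<open>G\<close>-compositions of \<open>n\<close>, and their sums span the invariants
  (\<open>invariant_eq_sum_orbit_sums\<close>). A partition is determined by its word and its shape, so \<open>F\<close> maps
  the orbit sum of shape \<open>\<alpha>\<close> to the sum of all \<open>u\<close> that \<open>\<alpha>\<close> cuts into increasing runs of constant
  colour (\<open>arrange_orbit_sum\<close>). Whether \<open>\<alpha>\<close> does so depends only on \<open>Co G n u\<close>, which is the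
  unique shortest such composition; so the image is \<open>Y G n \<alpha>\<close> plus a sum of \<open>Y G n \<beta>\<close> with \<open>\<beta>\<close>
  shorter than \<open>\<alpha>\<close>. Induction on the length expresses each \<open>Y G n \<alpha>\<close> by images
  (\<open>Y_in_image\<close>), and a shape of maximal length in the support of an invariant keeps its coefficient
  (\<open>arrange_eq_0\<close>).
\<close>

section \<open>Compositions of a coloured word into runs\<close>

definition positive :: "(nat \<times> 'g) list \<Rightarrow> bool" where
  "positive \<gamma> \<longleftrightarrow> (\<forall>x\<in>set \<gamma>. 0 < fst x)"

lemma positive_simps [simp]: "positive []" "positive (x # \<gamma>) \<longleftrightarrow> 0 < fst x \<and> positive \<gamma>"
  by (auto simp: positive_def)

text \<open>
  A coloured word is a list of pairs of a letter and a colour. The predicate is the block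
  condition of the definition of \<^const>\<open>Co\<close>, read off a word by recursion: \<open>\<gamma>\<close> cuts \<open>w\<close>
  into increasing segments of constant colour. The length bound and the demand that nothing is left
  over at the end make the parts add up to the length of the word.
\<close>

fun runs :: "(nat \<times> 'g) list \<Rightarrow> (nat \<times> 'g) list \<Rightarrow> bool" where
  "runs w [] \<longleftrightarrow> w = []"
| "runs w ((a, h) # \<gamma>) \<longleftrightarrow>
     a \<le> length w \<and> sorted_wrt (<) (map fst (take a w)) \<and> (\<forall>x\<in>set (take a w). snd x = h) \<and>
     runs (drop a w) \<gamma>"

definition ascent :: "nat \<times> 'g \<Rightarrow> nat \<times> 'g \<Rightarrow> bool" where
  "ascent x y \<longleftrightarrow> fst x < fst y \<and> snd x = snd y"

text \<open>
  The lengths and colours of the maximal runs. Scanned from the right, each letter either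
  lengthens the first run of the rest or starts a run of its own.
\<close>

fun run_shape :: "(nat \<times> 'g) list \<Rightarrow> (nat \<times> 'g) list" where
  "run_shape [] = []"
| "run_shape [x] = [(1, snd x)]"
| "run_shape (x # y # w) =
     (if ascent x y then (Suc (fst (hd (run_shape (y # w)))), snd x) # tl (run_shape (y # w))
      else (1, snd x) # run_shape (y # w))"

lemma run_shape_Cons: "\<exists>a \<gamma>. run_shape (x # w) = (Suc a, snd x) # \<gamma>"
  by (cases w) auto

lemma runs_sum: "runs w \<gamma> \<Longrightarrow> sum_list (map fst \<gamma>) = length w"
  by (induction w \<gamma> rule: runs.induct) auto

lemma runs_single: "runs (x # w) ((Suc 0, h) # \<gamma>) \<longleftrightarrow> snd x = h \<and> runs w \<gamma>"
  by auto

lemma runs_extend: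
  "runs (x # y # w) ((Suc (Suc a), h) # \<gamma>) \<longleftrightarrow>
     ascent x y \<and> snd x = h \<and> runs (y # w) ((Suc a, h) # \<gamma>)"
proof -
  have "sorted_wrt (<) (fst x # fst y # map fst (take a w)) \<longleftrightarrow>
      fst x < fst y \<and> sorted_wrt (<) (fst y # map fst (take a w))"
    by (rule sorted_wrt2) simp
  then show ?thesis by (auto simp: ascent_def simp del: sorted_wrt.simps)
qed

text \<open>
  The inductions in \<open>run_shape_minimal\<close> and \<open>runs_cong\<close> distinguish whether the first part of the
  composition ends after the first letter or covers the second letter too.
\<close>

lemma runs_ConsE:
  assumes "runs (x # y # w) \<gamma>" "positive \<gamma>"
  obtains (single) \<gamma>' where "\<gamma> = (1, snd x) # \<gamma>'" "runs (y # w) \<gamma>'" "positive \<gamma>'"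
  | (extend) a \<gamma>' where "\<gamma> = (Suc (Suc a), snd x) # \<gamma>'" "ascent x y"
      "runs (y # w) ((Suc a, snd x) # \<gamma>')" "positive ((Suc a, snd x) # \<gamma>')"
proof (cases \<gamma>)
  case Nil
  then show ?thesis using assms by simp
next
  case (Cons p \<gamma>')
  then obtain a h where p: "\<gamma> = (a, h) # \<gamma>'" by (cases p) auto
  show ?thesis
  proof (cases "a = 1")
    case True
    then show ?thesis using assms p single by (simp add: runs_single del: runs.simps)
  next
    case False
    moreover have "0 < a" using assms p by simp
    ultimately obtain b where "a = Suc (Suc b)" by (cases a rule: nat.exhaust; cases "a - 1") auto
    then show ?thesis using assms p extend by (simp add: runs_extend del: runs.simps)
  qed
qed

lemma runs_singletonD:
  assumes "runs [x] \<gamma>" "positive \<gamma>"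
  shows "\<gamma> = [(1, snd x)]"
proof (cases \<gamma>)
  case Nil
  then show ?thesis using assms by simp
next
  case (Cons p \<gamma>')
  then obtain a h where p: "\<gamma> = (a, h) # \<gamma>'" by (cases p) auto
  then have "a = 1" using assms by simp
  then have "runs [] \<gamma>'" "h = snd x" using assms p by auto
  then show ?thesis using p assms \<open>a = 1\<close> by (cases \<gamma>') auto
qed

lemma positive_run_shape: "positive (run_shape w)"
proof (induction w rule: run_shape.induct)
  case (3 x y w)
  then show ?case using run_shape_Cons[of y w] by auto
qed auto

lemma runs_run_shape: "runs w (run_shape w)"
proof (induction w rule: run_shape.induct)
  case (3 x y w)
  obtain a \<gamma> where "run_shape (y # w) = (Suc a, snd y) # \<gamma>" using run_shape_Cons by blast
  then show ?case
    using 3 by (auto simp: runs_extend runs_single ascent_def simp del: runs.simps)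
qed auto

text \<open>
  By induction on the word: if the first two letters form an ascent, a composition that separates
  them is longer than necessary by at least one part; if they do not, every composition has to
  separate them. This makes the shortest composition unique, which \<^const>\<open>Co\<close> presupposes.
\<close>

lemma run_shape_minimal:
  assumes "runs w \<gamma>" "positive \<gamma>"
  shows "length (run_shape w) < length \<gamma> \<or> \<gamma> = run_shape w"
  using assms
proof (induction w arbitrary: \<gamma> rule: run_shape.induct)
  case 1
  then show ?case by (cases \<gamma>) auto
next
  case (2 x)
  then show ?case using runs_singletonD by fastforce
next
  case (3 x y w)
  obtain a \<delta> where sh: "run_shape (y # w) = (Suc a, snd y) # \<delta>" using run_shape_Cons by blast
  from 3(4,5) show ?case
  proof (cases rule: runs_ConsE)
    case (single \<gamma>')
    then show ?thesis using 3(1,3)[of \<gamma>'] sh by (cases "ascent x y") auto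
  next
    case (extend b \<gamma>')
    then show ?thesis
      using 3(1)[of "(Suc b, snd x) # \<gamma>'"] sh by (auto simp: ascent_def simp del: runs.simps)
  qed
qed

text \<open>
  Which compositions fit a word depends only on its colours and on the places without an ascent,
  and both can be read off the composition into maximal runs.
\<close>

lemma runs_cong:
  assumes "run_shape w = run_shape w'" "positive \<gamma>" "runs w \<gamma>"
  shows "runs w' \<gamma>"
  using assms
proof (induction w arbitrary: w' \<gamma> rule: run_shape.induct)
  case 1
  have "w' = []"
  proof (cases w')
    case (Cons x v)
    then show ?thesis using 1 run_shape_Cons[of x v] by auto
  qed
  then show ?case using 1 by simp
next
  case (2 x)
  then have "\<gamma> = run_shape w'" using runs_singletonD by fastforce
  then show ?case by (simp add: runs_run_shape)
next
  case (3 x y w)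
  obtain a \<delta> where sh: "run_shape (y # w) = (Suc a, snd y) # \<delta>" using run_shape_Cons by blast
  obtain x' y' v where w': "w' = x' # y' # v"
    using "3.prems"(1) sh by (cases w' rule: run_shape.cases) (auto split: if_splits)
  obtain a' \<delta>' where sh': "run_shape (y' # v) = (Suc a', snd y') # \<delta>'"
    using run_shape_Cons by blast
  have eq: "ascent x y = ascent x' y'" "snd x = snd x'" "run_shape (y # w) = run_shape (y' # v)"
    using "3.prems"(1) sh sh' by (auto simp: w' ascent_def split: if_splits)
  have IH: "runs (y' # v) \<gamma>'" if "runs (y # w) \<gamma>'" "positive \<gamma>'" for \<gamma>'
    using "3.IH"(1,3) eq(3) that by blast
  from "3.prems"(3,2) show ?case
  proof (cases rule: runs_ConsE)
    case (single \<gamma>')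
    then show ?thesis using IH eq by (simp add: w' runs_single del: runs.simps)
  next
    case (extend b \<gamma>')
    then show ?thesis using IH[OF extend(3,4)] eq by (simp add: w' runs_extend del: runs.simps)
  qed
qed

lemma run_shape_append_decreasing:
  assumes "\<And>x. x \<in> set w \<Longrightarrow> fst x < m"
  shows "run_shape (map (\<lambda>j. (j, h)) [m..<m + Suc a] @ w) = (Suc a, h) # run_shape w"
  using assms
proof (induction a arbitrary: m)
  case 0
  show ?case
  proof (cases w)
    case (Cons x v)
    then show ?thesis using 0[of x] by (simp add: ascent_def)
  qed simp
next
  case (Suc a)
  have "run_shape (map (\<lambda>j. (j, h)) [Suc m..<Suc m + Suc a] @ w) = (Suc a, h) # run_shape w"
    using Suc.prems by (intro Suc.IH) fastforce
  moreover have "[Suc m..<Suc m + Suc a] = Suc m # [Suc (Suc m)..<Suc m + Suc a]"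
    "[m..<m + Suc (Suc a)] = m # [Suc m..<Suc m + Suc a]"
    by (simp_all add: upt_conv_Cons)
  ultimately show ?case by (simp add: ascent_def del: upt_Suc)
qed

text \<open>
  A witness gives the largest letters, in increasing order, to the first run, the next largest to
  the second, and so on: then every boundary between two runs is a descent.
\<close>

lemma exists_word_of_run_shape:
  assumes "positive \<alpha>"
  shows "\<exists>w. run_shape w = \<alpha> \<and> distinct (map fst w) \<and>
    fst ` set w = {1..sum_list (map fst \<alpha>)} \<and> snd ` set w \<subseteq> snd ` set \<alpha>"
  using assms
proof (induction \<alpha>)
  case Nil
  then show ?case by (intro exI[of _ "[]"]) auto
next
  case (Cons p \<alpha>)
  obtain a h where p: "p = (Suc a, h)" using Cons.prems by (cases p) (auto simp: gr0_conv_Suc)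
  define s where "s = sum_list (map fst \<alpha>)"
  obtain w where w: "run_shape w = \<alpha>" "distinct (map fst w)" "fst ` set w = {1..s}"
      "snd ` set w \<subseteq> snd ` set \<alpha>"
    using Cons by (auto simp: s_def)
  let ?v = "map (\<lambda>j. (j, h)) [Suc s..<Suc s + Suc a] @ w"
  have "run_shape ?v = p # \<alpha>"
    unfolding p w(1)[symmetric] by (rule run_shape_append_decreasing) (use w(3) in \<open>metis atLeastAtMost_iff image_eqI le_imp_less_Suc\<close>)
  moreover have "distinct (map fst ?v)"
    using w(2,3) by (auto simp: comp_def simp flip: set_map simp del: upt_Suc)
  moreover have "fst ` set ?v = {1..sum_list (map fst (p # \<alpha>))}"
    using w(3) by (auto simp: image_Un image_image p simp flip: s_def simp del: upt_Suc)
  moreover have "snd ` set ?v \<subseteq> snd ` set (p # \<alpha>)"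
    using w(4) by (auto simp: p)
  ultimately show ?case by blast
qed

section \<open>Ordered \<open>G\<close>-partitions as coloured words cut into runs\<close>

text \<open>
  This word is what remains of the product of \<open>P\<close> with the partition of \<open>{1..n}\<close> into
  singletons, listed in increasing order with neutral colours: each block is broken up into its
  elements.
\<close>

definition listing :: "(nat set \<times> 'g) list \<Rightarrow> (nat \<times> 'g) list" where
  "listing P = concat (map (\<lambda>(B, g). map (\<lambda>j. (j, g)) (sorted_list_of_set B)) P)"

text \<open>
  The composition that indexes the orbit of \<open>P\<close> under the symmetric group.
\<close>

definition shape :: "(nat set \<times> 'g) list \<Rightarrow> (nat \<times> 'g) list" where
  "shape P = map (\<lambda>(B, g). (card B, g)) P"

fun cut_blocks :: "nat list \<Rightarrow> (nat \<times> 'g) list \<Rightarrow> (nat set \<times> 'g) list" where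
  "cut_blocks l [] = []"
| "cut_blocks l ((a, h) # \<gamma>) = (set (take a l), h) # cut_blocks (drop a l) \<gamma>"

definition is_word :: "('g, 'm) monoid_scheme \<Rightarrow> nat \<Rightarrow> (nat \<times> 'g) list \<Rightarrow> bool" where
  "is_word G n w \<longleftrightarrow> distinct (map fst w) \<and> fst ` set w = {1..n} \<and> snd ` set w \<subseteq> carrier G"

lemma listing_simps [simp]:
  "listing [] = []"
  "listing ((B, g) # P) = map (\<lambda>j. (j, g)) (sorted_list_of_set B) @ listing P"
  by (simp_all add: listing_def)

lemma listing_append: "listing (P @ Q) = listing P @ listing Q"
  by (simp add: listing_def)

lemma shape_simps [simp]: "shape [] = []" "shape ((B, g) # P) = (card B, g) # shape P"
  by (simp_all add: shape_def)

text \<open>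
  Together with the converse \<open>listing_shape_cut_blocks\<close> this shows that an ordered
  \<open>G\<close>-partition carries the same information as a word and a composition of it into runs.
\<close>

lemma cut_blocks_listing:
  assumes "\<forall>p\<in>set P. finite (fst p)"
  shows "cut_blocks (map fst (listing P)) (shape P) = P"
  using assms by (induction P) (auto simp: comp_def)

lemma runs_listing:
  assumes "\<forall>p\<in>set P. finite (fst p)"
  shows "runs (listing P) (shape P)"
  using assms by (induction P) (auto simp: comp_def)

lemma listing_shape_cut_blocks:
  assumes "runs w \<gamma>"
  shows "listing (cut_blocks (map fst w) \<gamma>) = w \<and> shape (cut_blocks (map fst w) \<gamma>) = \<gamma>"
  using assms
proof (induction w \<gamma> rule: runs.induct)
  case (1 w)
  then show ?case by simp
next
  case (2 w a h \<gamma>)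
  then have inc: "sorted_wrt (<) (map fst (take a w))" and col: "\<forall>x\<in>set (take a w). snd x = h"
    and le: "a \<le> length w" and IH: "listing (cut_blocks (map fst (drop a w)) \<gamma>) = drop a w"
      "shape (cut_blocks (map fst (drop a w)) \<gamma>) = \<gamma>"
    by auto
  have "card (set (map fst (take a w))) = a"
    using le distinct_card[of "map fst (take a w)"] inc by (simp add: strict_sorted_iff)
  moreover have "map (\<lambda>j. (j, h)) (map fst (take a w)) = take a w"
    using col by (auto intro!: map_idI simp: comp_def)
  moreover have "sorted_list_of_set (set (map fst (take a w))) = map fst (take a w)"
    using inc by (metis sorted_list_of_set.idem_if_sorted_distinct strict_sorted_iff subset_UNIV map_ident)
  ultimately show ?case using IH by (simp add: take_map drop_map del: map_map)
qed

lemma cut_blocks_map: "cut_blocks (map \<sigma> l) \<gamma> = perm_act \<sigma> (cut_blocks l \<gamma>)"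
  by (induction l \<gamma> rule: cut_blocks.induct) (auto simp: perm_act_def take_map drop_map)

lemma map_fst_listing: "map fst (listing P) = concat (map sorted_list_of_set (map fst P))"
  by (induction P) (auto simp: comp_def)

lemma distinct_concat_sorted_list_of_set:
  assumes "\<forall>B\<in>set Bs. finite B \<and> B \<noteq> {}"
  shows "distinct (concat (map sorted_list_of_set Bs)) \<longleftrightarrow> distinct Bs \<and> disjoint (set Bs)"
  using assms
proof (induction Bs)
  case Nil
  then show ?case by simp
next
  case (Cons B Bs)
  have U: "set (concat (map sorted_list_of_set Bs)) = \<Union>(set Bs)"
    using Cons.prems by simp
  have "B \<notin> set Bs \<and> disjoint (insert B (set Bs)) \<longleftrightarrow> B \<inter> \<Union>(set Bs) = {} \<and> disjoint (set Bs)"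
    using Cons.prems by (auto simp: pairwise_insert disjnt_def)
  moreover have "distinct (concat (map sorted_list_of_set (B # Bs))) \<longleftrightarrow>
      B \<inter> \<Union>(set Bs) = {} \<and> distinct (concat (map sorted_list_of_set Bs))"
    using Cons.prems by (auto simp: U simp del: set_concat)
  ultimately show ?case using Cons by (simp only: list.set distinct.simps ball_simps) blast
qed

text \<open>
  Passing to words replaces the disjointness of a family of blocks by the distinctness of a list
  of letters; closure under the product and the bijection with runs are checked in this form.
\<close>

lemma ordered_G_partition_iff:
  "ordered_G_partition G n P \<longleftrightarrow>
     (\<forall>p\<in>set P. finite (fst p) \<and> fst p \<noteq> {}) \<and> is_word G n (listing P)"
proof (cases "\<forall>B\<in>set (map fst P). finite B \<and> B \<noteq> {}")
  case True
  have U: "fst ` set (listing P) = \<Union>(fst ` set P)"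
    using True by (fastforce simp: listing_def image_iff split_beta)
  have C: "snd ` set (listing P) = snd ` set P"
    using True by (fastforce simp: listing_def image_iff split_beta)
  show ?thesis
    using True distinct_concat_sorted_list_of_set[OF True]
    by (auto simp: ordered_G_partition_def ordered_partition_def partition_on_def is_word_def
        map_fst_listing U C simp del: map_map)
next
  case False
  have "finite B \<and> B \<noteq> {}" if "partition_on {1..n} (set (map fst P))" "B \<in> set (map fst P)" for B
    using that by (metis finite_atLeastAtMost partition_onD1 partition_onD3 finite_subset Union_upper)
  then show ?thesis using False
    by (auto simp: ordered_G_partition_def ordered_partition_def)
qed

section \<open>From ordered \<open>G\<close>-partitions to the wreath product\<close>

definition word :: "nat \<Rightarrow> (nat \<Rightarrow> nat) \<times> (nat \<Rightarrow> 'g) \<Rightarrow> (nat \<times> 'g) list" where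
  "word n u = map (\<lambda>i. (fst u i, snd u i)) [1..<Suc n]"

lemma carrier_wreath_product:
  "u \<in> carrier (wreath_product G n) \<longleftrightarrow>
     fst u permutes {1..n} \<and> snd u \<in> {1..n} \<rightarrow>\<^sub>E carrier G"
  by (cases u) (simp add: wreath_product_def sym_group_def)

lemma carrier_G_partition_monoid [simp]:
  "P \<in> carrier (G_partition_monoid G n) \<longleftrightarrow> ordered_G_partition G n P"
  by (simp add: G_partition_monoid_def)

lemma set_word: "set (word n u) = (\<lambda>i. (fst u i, snd u i)) ` {1..n}"
  by (auto simp: word_def simp del: upt_Suc)

lemma length_is_word: "is_word G n w \<Longrightarrow> length w = n"
  using distinct_card[of "map fst w"] by (simp add: is_word_def)

lemma is_word_word:
  assumes "u \<in> carrier (wreath_product G n)"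
  shows "is_word G n (word n u)"
proof -
  have perm: "fst u permutes {1..n}" and "snd u \<in> {1..n} \<rightarrow>\<^sub>E carrier G"
    using assms by (auto simp: carrier_wreath_product)
  then have "snd ` set (word n u) \<subseteq> carrier G" by (auto simp: set_word)
  moreover have "fst ` set (word n u) = {1..n}"
    using permutes_image[OF perm] by (simp add: set_word image_image)
  moreover have "distinct (map (fst u) [1..<Suc n])"
    using permutes_inj[OF perm] by (auto simp: distinct_map inj_on_def inj_def simp del: upt_Suc)
  ultimately show ?thesis by (simp add: is_word_def word_def comp_def del: upt_Suc)
qed

lemma bij_betw_word:
  "bij_betw (word n) (carrier (wreath_product G n)) {w. is_word G n w}"
proof (intro bij_betw_imageI)
  show "inj_on (word n) (carrier (wreath_product G n))"
  proof (rule inj_onI)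
    fix u v assume u: "u \<in> carrier (wreath_product G n)" and v: "v \<in> carrier (wreath_product G n)"
      and eq: "word n u = word n v"
    have *: "fst u i = fst v i \<and> snd u i = snd v i" if "i \<in> {1..n}" for i
      using eq that by (auto simp: word_def simp del: upt_Suc)
    have "fst u i = fst v i" for i
      using * u v by (cases "i \<in> {1..n}") (auto simp: carrier_wreath_product permutes_def)
    moreover have "snd u = snd v"
      by (rule PiE_ext[of _ "{1..n}" "\<lambda>_. carrier G"]) (use * u v in \<open>auto simp: carrier_wreath_product\<close>)
    ultimately show "u = v" by (auto simp: prod_eq_iff)
  qed
  show "word n ` carrier (wreath_product G n) = {w. is_word G n w}"
  proof (intro equalityI subsetI)
    fix w assume "w \<in> {w. is_word G n w}"
    then have w: "is_word G n w" by simp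
    define \<pi> where "\<pi> = (\<lambda>i. if i \<in> {1..n} then fst (w ! (i - 1)) else i)"
    define g where "g = (\<lambda>i\<in>{1..n}. snd (w ! (i - 1)))"
    have len: "length w = n" using w by (rule length_is_word)
    have eq: "word n (\<pi>, g) = w"
      by (rule nth_equalityI) (auto simp: word_def len \<pi>_def g_def simp del: upt_Suc)
    have im: "\<pi> ` {1..n} = {1..n}"
      using w arg_cong[OF eq, of "\<lambda>w. fst ` set w"] by (simp add: set_word image_image is_word_def)
    then have "inj_on \<pi> {1..n}" by (intro eq_card_imp_inj_on) auto
    then have "\<pi> permutes {1..n}"
      using im by (intro bij_imp_permutes) (auto simp: bij_betw_def \<pi>_def)
    moreover have "snd (w ! (i - 1)) \<in> carrier G" if "i \<in> {1..n}" for i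
      using w nth_mem[of "i - 1" w] that len by (fastforce simp: is_word_def)
    then have "g \<in> {1..n} \<rightarrow>\<^sub>E carrier G" by (auto simp: g_def)
    ultimately show "w \<in> word n ` carrier (wreath_product G n)"
      using eq by (intro image_eqI[of _ _ "(\<pi>, g)"]) (auto simp: carrier_wreath_product)
  qed (auto intro: is_word_word)
qed

definition arrangement ::
  "('g, 'm) monoid_scheme \<Rightarrow> nat \<Rightarrow> (nat set \<times> 'g) list \<Rightarrow> (nat \<Rightarrow> nat) \<times> (nat \<Rightarrow> 'g)" where
  "arrangement G n P = inv_into (carrier (wreath_product G n)) (word n) (listing P)"

lemma arrangement:
  assumes "ordered_G_partition G n P"
  shows "arrangement G n P \<in> carrier (wreath_product G n)" "word n (arrangement G n P) = listing P"
proof -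
  have "listing P \<in> word n ` carrier (wreath_product G n)"
    using assms bij_betw_imp_surj_on[OF bij_betw_word[of n G]] by (auto simp: ordered_G_partition_iff)
  then show "arrangement G n P \<in> carrier (wreath_product G n)"
      "word n (arrangement G n P) = listing P"
    unfolding arrangement_def by (auto intro: inv_into_into f_inv_into_f)
qed

lemma arrangement_eqI:
  assumes "u \<in> carrier (wreath_product G n)" "word n u = listing P"
  shows "arrangement G n P = u"
  using assms bij_betw_imp_inj_on[OF bij_betw_word[of n G]]
  unfolding arrangement_def by (metis inv_into_f_f)

text \<open>
  The effect of one block \<open>(B, g)\<close>, multiplied from the left, on the word of the right
  factor.
\<close>

definition relabel :: "('g, 'm) monoid_scheme \<Rightarrow> nat set \<Rightarrow> 'g \<Rightarrow> (nat \<times> 'g) list \<Rightarrow> (nat \<times> 'g) list" where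
  "relabel G B g w = map (\<lambda>(j, h). (j, h \<otimes>\<^bsub>G\<^esub> g)) (filter (\<lambda>(j, h). j \<in> B) w)"

lemma relabel_append: "relabel G B g (v @ w) = relabel G B g v @ relabel G B g w"
  by (simp add: relabel_def)

lemma filter_sorted_list_of_set:
  assumes "finite C"
  shows "filter (\<lambda>j. j \<in> B) (sorted_list_of_set C) = sorted_list_of_set (B \<inter> C)"
  by (rule sorted_distinct_set_unique) (use assms in \<open>auto intro: sorted_wrt_filter\<close>)

lemma mult_G_partition_monoid:
  "P \<otimes>\<^bsub>G_partition_monoid G n\<^esub> Q =
     concat (map (\<lambda>(B, g). concat (map (\<lambda>(C, h).
       if B \<inter> C \<noteq> {} then [(B \<inter> C, h \<otimes>\<^bsub>G\<^esub> g)] else []) Q)) P)"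
  by (simp add: G_partition_monoid_def)

lemma listing_mult:
  assumes "\<forall>q\<in>set Q. finite (fst q)"
  shows "listing (P \<otimes>\<^bsub>G_partition_monoid G n\<^esub> Q) =
    concat (map (\<lambda>(B, g). relabel G B g (listing Q)) P)"
proof -
  have "listing (concat (map (\<lambda>(C, h).
       if B \<inter> C \<noteq> {} then [(B \<inter> C, h \<otimes>\<^bsub>G\<^esub> g)] else []) Q)) = relabel G B g (listing Q)" for B g
    using assms
  proof (induction Q)
    case (Cons q Q)
    obtain C h where q: "q = (C, h)" by (cases q)
    have "relabel G B g (map (\<lambda>j. (j, h)) (sorted_list_of_set C)) =
        map (\<lambda>j. (j, h \<otimes>\<^bsub>G\<^esub> g)) (sorted_list_of_set (B \<inter> C))"
      using Cons.prems by (simp add: q relabel_def filter_map comp_def filter_sorted_list_of_set)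
    then show ?case using Cons by (simp add: q relabel_append)
  qed (simp add: relabel_def)
  then show ?thesis
    unfolding mult_G_partition_monoid by (induction P) (auto simp: listing_append)
qed

text \<open>
  The letters of the word of \<open>(\<tau>, h)\<close> that lie in \<open>B\<close> are kept in the order of their positions,
  and these positions form the set \<open>\<tau>\<^sup>-\<^sup>1 B\<close>.
\<close>

lemma relabel_word:
  assumes "\<tau> permutes {1..n}" "B \<subseteq> {1..n}"
  shows "relabel G B g (word n (\<tau>, h)) =
    map (\<lambda>(i, k). (\<tau> i, h i \<otimes>\<^bsub>G\<^esub> k)) (map (\<lambda>i. (i, g)) (sorted_list_of_set (inv_into UNIV \<tau> ` B)))"
proof -
  have "inv_into UNIV \<tau> ` B = \<tau> -` B"
    using permutes_bij[OF assms(1)] by (simp add: bij_vimage_eq_inv_image)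
  moreover have "\<tau> -` B \<subseteq> {1..n}"
    using assms(2) permutes_in_image[OF assms(1)] by blast
  ultimately have "inv_into UNIV \<tau> ` B = (\<tau> -` B) \<inter> {1..n}" by blast
  moreover have "filter (\<lambda>i. \<tau> i \<in> B) [1..<Suc n] = sorted_list_of_set ((\<tau> -` B) \<inter> {1..n})"
    by (rule sorted_distinct_set_unique) (auto intro: sorted_wrt_filter simp del: upt_Suc)
  ultimately show ?thesis
    by (simp add: relabel_def word_def filter_map comp_def del: upt_Suc)
qed

lemma word_mult:
  "word n (w \<otimes>\<^bsub>wreath_product G n\<^esub> u) =
    map (\<lambda>(i, k). (fst w i, snd w i \<otimes>\<^bsub>G\<^esub> k)) (word n u)"
  by (auto simp: word_def wreath_product_def split_beta simp del: upt_Suc)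

lemma wreath_product_m_closed:
  assumes "group G" "w \<in> carrier (wreath_product G n)" "u \<in> carrier (wreath_product G n)"
  shows "w \<otimes>\<^bsub>wreath_product G n\<^esub> u \<in> carrier (wreath_product G n)"
proof -
  interpret group G by fact
  have "fst u i \<in> {1..n}" if "i \<in> {1..n}" for i
    using assms(3) that permutes_in_image by (fastforce simp: carrier_wreath_product)
  moreover have "snd w i \<in> carrier G" "snd u i \<in> carrier G" if "i \<in> {1..n}" for i
    using assms(2,3) that by (auto simp: carrier_wreath_product)
  ultimately have "snd w (fst u i) \<otimes>\<^bsub>G\<^esub> snd u i \<in> carrier G" if "i \<in> {1..n}" for i
    using that by (intro m_closed) blast+
  moreover have "fst w \<circ> fst u permutes {1..n}"
    using assms(2,3) by (auto simp: carrier_wreath_product intro: permutes_compose)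
  ultimately show ?thesis
    unfolding carrier_wreath_product by (simp add: wreath_product_def split_beta)
qed

lemma perm_act_closed:
  assumes "\<sigma> permutes {1..n}" "ordered_G_partition G n P"
  shows "ordered_G_partition G n (perm_act \<sigma> P)"
proof -
  have inj: "inj \<sigma>" using assms(1) by (rule permutes_inj)
  have fst: "map fst (perm_act \<sigma> P) = map ((`) \<sigma>) (map fst P)"
    and snd: "map snd (perm_act \<sigma> P) = map snd P"
    by (auto simp: perm_act_def)
  have "inj_on ((`) \<sigma>) Bs" for Bs using inj by (auto simp: inj_on_def inj_image_eq_iff)
  moreover have "partition_on {1..n} ((`) \<sigma> ` Bs)" if "partition_on {1..n} Bs" for Bs
  proof -
    have "{} \<notin> (`) \<sigma> ` Bs" using that by (auto simp: partition_on_def)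
    then show ?thesis
      using partition_on_inj_image[OF that, of \<sigma>] inj permutes_image[OF assms(1)]
      by (auto simp: inj_on_subset)
  qed
  ultimately show ?thesis
    using assms(2) unfolding ordered_G_partition_def ordered_partition_def fst snd
    by (auto simp: distinct_map simp del: map_map)
qed

lemma perm_act_mult:
  assumes "inj \<sigma>"
  shows "perm_act \<sigma> (P \<otimes>\<^bsub>G_partition_monoid G n\<^esub> Q) =
    perm_act \<sigma> P \<otimes>\<^bsub>G_partition_monoid G n\<^esub> perm_act \<sigma> Q"
proof -
  have "perm_act \<sigma> (concat (map (\<lambda>(C, h).
         if B \<inter> C \<noteq> {} then [(B \<inter> C, h \<otimes>\<^bsub>G\<^esub> g)] else []) Q)) =
      concat (map (\<lambda>(C, h). if \<sigma> ` B \<inter> C \<noteq> {} then [(\<sigma> ` B \<inter> C, h \<otimes>\<^bsub>G\<^esub> g)] else [])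
        (perm_act \<sigma> Q))" for B g
    by (induction Q) (auto simp: perm_act_def simp flip: image_Int[OF assms])
  then show ?thesis
    unfolding mult_G_partition_monoid by (induction P) (auto simp: perm_act_def)
qed

text \<open>
  The product \<open>P Q\<close> sorts the word of \<open>Q\<close> by the blocks of \<open>P\<close>. Renaming the letters by
  the inverse of the permutation \<open>\<tau>\<close> of \<open>Q\<close> turns this into sorting the identity word by the
  blocks of \<open>\<tau>\<^sup>-\<^sup>1 P\<close>, and renaming them back is left multiplication by the arrangement of \<open>Q\<close>.
  Hence the order of the factors is reversed, at the cost of moving \<open>P\<close> within its orbit.
\<close>

lemma listing_mult_eq_word:
  assumes "ordered_G_partition G n P" "ordered_G_partition G n Q"
  defines "w \<equiv> arrangement G n Q"
  shows "listing (P \<otimes>\<^bsub>G_partition_monoid G n\<^esub> Q) =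
    word n (w \<otimes>\<^bsub>wreath_product G n\<^esub> arrangement G n (perm_act (inv_into UNIV (fst w)) P))"
proof -
  let ?\<sigma> = "inv_into UNIV (fst w)"
  have w: "w \<in> carrier (wreath_product G n)" and wQ: "word n (fst w, snd w) = listing Q"
    using arrangement[OF assms(2)] by (auto simp: w_def)
  have perm: "fst w permutes {1..n}" using w by (simp add: carrier_wreath_product)
  have P': "ordered_G_partition G n (perm_act ?\<sigma> P)"
    using assms(1) permutes_inv[OF perm] by (rule perm_act_closed[rotated])
  have fin: "\<forall>q\<in>set Q. finite (fst q)" using assms(2) by (auto simp: ordered_G_partition_iff)
  have sub: "\<forall>p\<in>set P. fst p \<subseteq> {1..n}"
    using assms(1) by (auto simp: ordered_G_partition_def ordered_partition_def partition_on_def)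
  have "listing (P \<otimes>\<^bsub>G_partition_monoid G n\<^esub> Q) =
      concat (map (\<lambda>(B, g). relabel G B g (word n (fst w, snd w))) P)"
    unfolding wQ using fin by (rule listing_mult)
  also have "\<dots> = map (\<lambda>(i, k). (fst w i, snd w i \<otimes>\<^bsub>G\<^esub> k)) (listing (perm_act ?\<sigma> P))"
    using sub
  proof (induction P)
    case (Cons p P)
    then show ?case
      by (cases p) (simp add: perm_act_def relabel_word[OF perm] del: map_map prod.collapse)
  qed (simp add: perm_act_def)
  also have "\<dots> = word n (w \<otimes>\<^bsub>wreath_product G n\<^esub> arrangement G n (perm_act ?\<sigma> P))"
    by (simp add: word_mult arrangement[OF P'])
  finally show ?thesis .
qed

lemma G_partition_mult:
  assumes "group G" "ordered_G_partition G n P" "ordered_G_partition G n Q"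
  shows "ordered_G_partition G n (P \<otimes>\<^bsub>G_partition_monoid G n\<^esub> Q)"
    and "arrangement G n (P \<otimes>\<^bsub>G_partition_monoid G n\<^esub> Q) =
      arrangement G n Q \<otimes>\<^bsub>wreath_product G n\<^esub>
        arrangement G n (perm_act (inv_into UNIV (fst (arrangement G n Q))) P)"
proof -
  let ?w = "arrangement G n Q"
  let ?P = "perm_act (inv_into UNIV (fst ?w)) P"
  have "?w \<in> carrier (wreath_product G n)" using arrangement assms(3) by blast
  moreover from this have "arrangement G n ?P \<in> carrier (wreath_product G n)"
    using assms(2) by (intro arrangement perm_act_closed permutes_inv) (auto simp: carrier_wreath_product)
  ultimately have W: "?w \<otimes>\<^bsub>wreath_product G n\<^esub> arrangement G n ?P \<in> carrier (wreath_product G n)"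
    by (rule wreath_product_m_closed[OF assms(1)])
  note eq = listing_mult_eq_word[OF assms(2,3)]
  have "\<forall>p\<in>set (P \<otimes>\<^bsub>G_partition_monoid G n\<^esub> Q). finite (fst p) \<and> fst p \<noteq> {}"
    using assms(2) by (auto simp: mult_G_partition_monoid ordered_G_partition_iff)
  then show "ordered_G_partition G n (P \<otimes>\<^bsub>G_partition_monoid G n\<^esub> Q)"
    using is_word_word[OF W] eq by (simp add: ordered_G_partition_iff)
  show "arrangement G n (P \<otimes>\<^bsub>G_partition_monoid G n\<^esub> Q) =
      ?w \<otimes>\<^bsub>wreath_product G n\<^esub> arrangement G n ?P"
    using W eq[symmetric] by (rule arrangement_eqI)
qed

lemma arrangement_one:
  assumes "group G" "n > 0"
  shows "ordered_G_partition G n \<one>\<^bsub>G_partition_monoid G n\<^esub>"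
    and "arrangement G n \<one>\<^bsub>G_partition_monoid G n\<^esub> = \<one>\<^bsub>wreath_product G n\<^esub>"
proof -
  interpret group G by fact
  show "ordered_G_partition G n \<one>\<^bsub>G_partition_monoid G n\<^esub>"
    using assms by (auto simp: ordered_G_partition_def ordered_partition_def G_partition_monoid_def
        partition_on_def)
  show "arrangement G n \<one>\<^bsub>G_partition_monoid G n\<^esub> = \<one>\<^bsub>wreath_product G n\<^esub>"
  proof (rule arrangement_eqI)
    show "\<one>\<^bsub>wreath_product G n\<^esub> \<in> carrier (wreath_product G n)"
      by (auto simp: carrier_wreath_product) (auto simp: wreath_product_def permutes_id)
    have "sorted_list_of_set {1..n} = [1..<Suc n]"
      by (rule sorted_distinct_set_unique) (auto simp del: upt_Suc)
    then show "word n \<one>\<^bsub>wreath_product G n\<^esub> = listing \<one>\<^bsub>G_partition_monoid G n\<^esub>"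
      by (auto simp: word_def wreath_product_def G_partition_monoid_def simp del: upt_Suc)
  qed
qed

lemma perm_act_one: "\<sigma> permutes {1..n} \<Longrightarrow> perm_act \<sigma> \<one>\<^bsub>G_partition_monoid G n\<^esub> = \<one>\<^bsub>G_partition_monoid G n\<^esub>"
  using permutes_image by (force simp: perm_act_def G_partition_monoid_def)

text \<open>
  The permutation that carries the word of \<open>P\<close> to the word of \<open>Q\<close> position by position also
  carries blocks to blocks, since blocks of equal sizes occupy equal positions.
\<close>

lemma same_shape_imp_perm_act:
  assumes "ordered_G_partition G n P" "ordered_G_partition G n Q" "shape P = shape Q"
  obtains \<sigma> where "\<sigma> permutes {1..n}" "perm_act \<sigma> P = Q"
proof -
  let ?\<pi> = "fst (arrangement G n P)" and ?\<tau> = "fst (arrangement G n Q)"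
  let ?\<sigma> = "?\<tau> \<circ> inv_into UNIV ?\<pi>"
  have \<pi>: "?\<pi> permutes {1..n}" and \<tau>: "?\<tau> permutes {1..n}"
    using arrangement(1)[OF assms(1)] arrangement(1)[OF assms(2)]
    by (auto simp: carrier_wreath_product)
  have l: "map fst (listing P) = map ?\<pi> [1..<Suc n]" "map fst (listing Q) = map ?\<tau> [1..<Suc n]"
    unfolding arrangement(2)[OF assms(1), symmetric] arrangement(2)[OF assms(2), symmetric]
    by (auto simp: word_def simp del: upt_Suc)
  have "map ?\<sigma> (map fst (listing P)) = map fst (listing Q)"
    unfolding l by (simp add: permutes_inverses(2)[OF \<pi>] del: upt_Suc)
  then have "perm_act ?\<sigma> (cut_blocks (map fst (listing P)) (shape P)) =
      cut_blocks (map fst (listing Q)) (shape Q)"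
    by (simp add: assms(3) flip: cut_blocks_map)
  then have "perm_act ?\<sigma> P = Q"
    using assms(1,2) by (simp add: cut_blocks_listing ordered_G_partition_iff)
  moreover have "?\<sigma> permutes {1..n}" using permutes_inv[OF \<pi>] \<tau> by (rule permutes_compose)
  ultimately show ?thesis using that by blast
qed

section \<open>The composition of an element of the wreath product\<close>

text \<open>
  The bridge from the recursive predicate to the indexed form in which \<^const>\<open>block_condition\<close>
  is given.
\<close>

lemma runs_iff_nth:
  "runs w \<gamma> \<longleftrightarrow> sum_list (map fst \<gamma>) = length w \<and>
     (\<forall>r<length \<gamma>. let v = take (fst (\<gamma> ! r)) (drop (sum_list (map fst (take r \<gamma>))) w)
        in sorted_wrt (<) (map fst v) \<and> (\<forall>x\<in>set v. snd x = snd (\<gamma> ! r)))"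
proof (induction w \<gamma> rule: runs.induct)
  case (2 w a h \<gamma>)
  have "sum_list (map fst ((a, h) # \<gamma>)) = length w \<longleftrightarrow>
      a \<le> length w \<and> sum_list (map fst \<gamma>) = length (drop a w)"
    by auto
  then show ?case
    unfolding length_Cons All_less_Suc2 using 2 by (auto simp: Let_def add.commute)
qed auto

lemma sum_list_take_Suc_le:
  fixes xs :: "nat list"
  assumes "r < length xs"
  shows "sum_list (take r xs) + xs ! r \<le> sum_list xs"
proof -
  have "sum_list (take r xs) + xs ! r = sum_list (take (Suc r) xs)"
    using assms by (simp add: take_Suc_conv_app_nth)
  also have "\<dots> \<le> sum_list (take (Suc r) xs) + sum_list (drop (Suc r) xs)" by simp
  also have "\<dots> = sum_list xs" by (simp flip: sum_list_append)
  finally show ?thesis .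
qed

lemma sorted_wrt_map_upt:
  "sorted_wrt (<) (map f [a..<b]) \<longleftrightarrow> strict_mono_on {a..<b} (f :: nat \<Rightarrow> nat)"
proof
  assume L: "sorted_wrt (<) (map f [a..<b])"
  show "strict_mono_on {a..<b} f"
  proof (rule strict_mono_onI)
    fix i j assume "i \<in> {a..<b}" "j \<in> {a..<b}" "i < j"
    then show "f i < f j"
      using sorted_wrt_nth_less[OF L, of "i - a" "j - a"] by auto
  qed
next
  assume "strict_mono_on {a..<b} f"
  then have "f (a + i) < f (a + j)" if "i < j" "j < b - a" for i j
    using that by (intro strict_mono_onD[of "{a..<b}" f]) auto
  then show "sorted_wrt (<) (map f [a..<b])"
    by (simp add: sorted_wrt_iff_nth_less)
qed

lemma runs_word_iff_block_condition:
  assumes "sum_list (map fst \<gamma>) = n"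
  shows "runs (word n u) \<gamma> \<longleftrightarrow> block_condition u \<gamma>"
proof -
  have len: "length (word n u) = n" by (simp add: word_def)
  have "(let v = take (fst (\<gamma> ! r)) (drop (sum_list (map fst (take r \<gamma>))) (word n u))
          in sorted_wrt (<) (map fst v) \<and> (\<forall>x\<in>set v. snd x = snd (\<gamma> ! r))) \<longleftrightarrow>
        (let s = sum_list (map fst (take r \<gamma>)); (a, h) = \<gamma> ! r
          in strict_mono_on {s + 1..s + a} (fst u) \<and> (\<forall>i\<in>{s + 1..s + a}. snd u i = h))"
    if "r < length \<gamma>" for r
  proof -
    obtain a h where ah: "\<gamma> ! r = (a, h)" by (cases "\<gamma> ! r")
    define s where "s = sum_list (map fst (take r \<gamma>))"
    have "s + a \<le> n"
      using sum_list_take_Suc_le[of r "map fst \<gamma>"] that assms ah by (simp add: s_def take_map)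
    then have "take a (drop s (word n u)) = map (\<lambda>i. (fst u i, snd u i)) [s + 1..<Suc (s + a)]"
      by (simp add: word_def take_map drop_map take_upt del: upt_Suc)
    then have "map fst (take a (drop s (word n u))) = map (fst u) [s + 1..<Suc (s + a)]"
        "set (take a (drop s (word n u))) = (\<lambda>i. (fst u i, snd u i)) ` {s + 1..s + a}"
      by (auto simp del: upt_Suc)
    moreover have "{s + 1..<Suc (s + a)} = {s + 1..s + a}" by auto
    ultimately show ?thesis
      unfolding ah s_def[symmetric] by (simp add: sorted_wrt_map_upt del: upt_Suc)
  qed
  then show ?thesis
    using assms len by (simp add: runs_iff_nth block_condition_def)
qed

lemma runs_colours:
  assumes "runs w \<gamma>" "positive \<gamma>"
  shows "snd ` set \<gamma> \<subseteq> snd ` set w"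
  using assms
proof (induction w \<gamma> rule: runs.induct)
  case (2 w a h \<gamma>)
  then have "take a w \<noteq> []" by auto
  then have "hd (take a w) \<in> set (take a w)" by (rule hd_in_set)
  then have "h \<in> snd ` set w" using 2 by (metis image_eqI in_set_takeD runs.simps(2))
  moreover have "snd ` set (drop a w) \<subseteq> snd ` set w"
    by (intro image_mono set_drop_subset)
  moreover have "snd ` set \<gamma> \<subseteq> snd ` set (drop a w)" using 2 by simp
  ultimately show ?case by simp
qed simp

lemma G_composition_iff_positive:
  "G_composition G n \<gamma> \<longleftrightarrow> positive \<gamma> \<and> snd ` set \<gamma> \<subseteq> carrier G \<and> sum_list (map fst \<gamma>) = n"
  by (auto simp: G_composition_def positive_def)

lemma runs_word_iff:
  assumes "u \<in> carrier (wreath_product G n)"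
  shows "positive \<gamma> \<and> runs (word n u) \<gamma> \<longleftrightarrow> G_composition G n \<gamma> \<and> block_condition u \<gamma>"
proof
  assume L: "positive \<gamma> \<and> runs (word n u) \<gamma>"
  then have "sum_list (map fst \<gamma>) = n" using runs_sum[of "word n u" \<gamma>] by (simp add: word_def)
  moreover have "snd ` set \<gamma> \<subseteq> carrier G"
    using L runs_colours[of "word n u" \<gamma>] is_word_word[OF assms] by (auto simp: is_word_def)
  ultimately show "G_composition G n \<gamma> \<and> block_condition u \<gamma>"
    using L runs_word_iff_block_condition[of \<gamma> n u] by (auto simp: G_composition_iff_positive)
next
  assume "G_composition G n \<gamma> \<and> block_condition u \<gamma>"
  then show "positive \<gamma> \<and> runs (word n u) \<gamma>"
    using runs_word_iff_block_condition[of \<gamma> n u] by (auto simp: G_composition_iff_positive)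
qed

lemma Co_eq_run_shape:
  assumes "u \<in> carrier (wreath_product G n)"
  shows "Co G n u = run_shape (word n u)"
  unfolding Co_def is_arg_min_def runs_word_iff[OF assms, symmetric]
proof (rule the_equality)
  show "(positive (run_shape (word n u)) \<and> runs (word n u) (run_shape (word n u))) \<and>
      \<not> (\<exists>\<beta>. (positive \<beta> \<and> runs (word n u) \<beta>) \<and> length \<beta> < length (run_shape (word n u)))"
    using positive_run_shape runs_run_shape run_shape_minimal by fastforce
  fix \<alpha> assume "(positive \<alpha> \<and> runs (word n u) \<alpha>) \<and>
      \<not> (\<exists>\<beta>. (positive \<beta> \<and> runs (word n u) \<beta>) \<and> length \<beta> < length \<alpha>)"
  then show "\<alpha> = run_shape (word n u)"
    using positive_run_shape runs_run_shape run_shape_minimal by blast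
qed

lemma G_composition_Co:
  assumes "u \<in> carrier (wreath_product G n)"
  shows "G_composition G n (Co G n u)"
  using runs_word_iff[OF assms] positive_run_shape runs_run_shape
  by (auto simp: Co_eq_run_shape[OF assms])

lemma exists_Co_eq:
  assumes "G_composition G n \<alpha>"
  obtains u where "u \<in> carrier (wreath_product G n)" "Co G n u = \<alpha>"
proof -
  obtain w where w: "run_shape w = \<alpha>" "is_word G n w"
    using assms exists_word_of_run_shape[of \<alpha>]
    by (fastforce simp: G_composition_iff_positive is_word_def)
  then have "w \<in> word n ` carrier (wreath_product G n)"
    by (simp add: bij_betw_imp_surj_on[OF bij_betw_word])
  then obtain u where "u \<in> carrier (wreath_product G n)" "word n u = w" by blast
  then show ?thesis using that w by (simp add: Co_eq_run_shape)
qed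

section \<open>Linear extensions\<close>

lemma lookup_sum_cmul_sum_frag_of:
  assumes "\<And>a. a \<in> A \<Longrightarrow> finite (S a)"
  shows "Poly_Mapping.lookup (\<Sum>a\<in>A. frag_cmul (c a) (\<Sum>s\<in>S a. frag_of s)) t =
    (\<Sum>a\<in>A. if t \<in> S a then c a else 0)"
  unfolding lookup_sum by (rule sum.cong[OF refl]) (simp add: lookup_sum assms)

lemma frag_extend_frag_extend:
  "frag_extend f (frag_extend g x) = frag_extend (\<lambda>a. frag_extend f (g a)) x"
  unfolding frag_extend_def[of g] frag_extend_def[of "\<lambda>a. frag_extend f (g a)"]
  by (simp add: frag_extend_sum comp_def frag_extend_cmul)

lemma frag_extend_swap:
  "frag_extend (\<lambda>a. frag_extend (\<lambda>b. f a b) y) x = frag_extend (\<lambda>b. frag_extend (\<lambda>a. f a b) x) y"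
  unfolding frag_extend_def frag_cmul_sum frag_cmul_cmul
  by (subst sum.swap) (simp add: mult.commute)

lemma lookup_frag_extend_inj:
  assumes "inj f"
  shows "Poly_Mapping.lookup (frag_extend (\<lambda>a. frag_of (f a)) x) (f a) = Poly_Mapping.lookup x a"
  using subset_UNIV
  by (induction x rule: frag_induction)
    (use assms in \<open>auto simp: frag_extend_diff lookup_minus inj_eq\<close>)

section \<open>Images of the orbit sums\<close>

definition arrange ::
  "('g, 'm) monoid_scheme \<Rightarrow> nat \<Rightarrow> ((nat set \<times> 'g) list \<Rightarrow>\<^sub>0 int) \<Rightarrow> ((nat \<Rightarrow> nat) \<times> (nat \<Rightarrow> 'g)) \<Rightarrow>\<^sub>0 int"
  where "arrange G n = frag_extend (\<lambda>P. frag_of (arrangement G n P))"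

definition partitions_of_shape ::
  "('g, 'm) monoid_scheme \<Rightarrow> nat \<Rightarrow> (nat \<times> 'g) list \<Rightarrow> (nat set \<times> 'g) list set" where
  "partitions_of_shape G n \<alpha> = {P. ordered_G_partition G n P \<and> shape P = \<alpha>}"

definition compatible_elements ::
  "('g, 'm) monoid_scheme \<Rightarrow> nat \<Rightarrow> (nat \<times> 'g) list \<Rightarrow> ((nat \<Rightarrow> nat) \<times> (nat \<Rightarrow> 'g)) set" where
  "compatible_elements G n \<alpha> = {u \<in> carrier (wreath_product G n). runs (word n u) \<alpha>}"

lemma G_composition_shape:
  assumes "ordered_G_partition G n P"
  shows "G_composition G n (shape P)"
proof -
  have b: "\<forall>p\<in>set P. finite (fst p) \<and> fst p \<noteq> {}"
    using assms by (simp add: ordered_G_partition_iff)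
  then have "positive (shape P)" by (auto simp: positive_def shape_def card_gt_0_iff)
  moreover have "runs (word n (arrangement G n P)) (shape P)"
    using b runs_listing[of P] arrangement(2)[OF assms] by simp
  ultimately show ?thesis using runs_word_iff arrangement(1)[OF assms] by blast
qed

lemma finite_partitions_of_shape: "finite (partitions_of_shape G n \<alpha>)"
proof (rule finite_subset)
  show "partitions_of_shape G n \<alpha> \<subseteq>
      {P. set P \<subseteq> Pow {1..n} \<times> snd ` set \<alpha> \<and> length P = length \<alpha>}"
    by (auto simp: partitions_of_shape_def shape_def ordered_G_partition_def
        ordered_partition_def partition_on_def image_iff split_beta) force+
  show "finite {P. set P \<subseteq> Pow {1..n} \<times> snd ` set \<alpha> \<and> length P = length \<alpha>}"
    by (rule finite_lists_length_eq) simp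
qed

text \<open>
  The partition is recovered from its arrangement by cutting the word at the places that the shape
  prescribes.
\<close>

lemma bij_betw_arrangement:
  assumes "positive \<alpha>"
  shows "bij_betw (arrangement G n) (partitions_of_shape G n \<alpha>) (compatible_elements G n \<alpha>)"
proof (rule bij_betw_byWitness[where f' = "\<lambda>u. cut_blocks (map fst (word n u)) \<alpha>"])
  show "\<forall>P\<in>partitions_of_shape G n \<alpha>.
      cut_blocks (map fst (word n (arrangement G n P))) \<alpha> = P"
    by (auto simp: partitions_of_shape_def arrangement(2) cut_blocks_listing ordered_G_partition_iff)
  show "arrangement G n ` partitions_of_shape G n \<alpha> \<subseteq> compatible_elements G n \<alpha>"
    by (auto simp: partitions_of_shape_def compatible_elements_def arrangement)
      (auto simp: ordered_G_partition_iff runs_listing)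
  show "\<forall>u\<in>compatible_elements G n \<alpha>. arrangement G n (cut_blocks (map fst (word n u)) \<alpha>) = u"
    by (intro ballI arrangement_eqI) (simp_all add: compatible_elements_def listing_shape_cut_blocks)
  show "(\<lambda>u. cut_blocks (map fst (word n u)) \<alpha>) ` compatible_elements G n \<alpha>
      \<subseteq> partitions_of_shape G n \<alpha>"
  proof (intro image_subsetI)
    fix u assume "u \<in> compatible_elements G n \<alpha>"
    then have u: "u \<in> carrier (wreath_product G n)" "runs (word n u) \<alpha>"
      by (auto simp: compatible_elements_def)
    let ?P = "cut_blocks (map fst (word n u)) \<alpha>"
    have P: "listing ?P = word n u" "shape ?P = \<alpha>"
      using listing_shape_cut_blocks[OF u(2)] by auto
    have "0 < card (fst p)" if "p \<in> set ?P" for p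
    proof -
      have "(card (fst p), snd p) \<in> set (shape ?P)"
        using that by (auto simp: shape_def split_beta)
      then show ?thesis using assms unfolding P(2) by (auto simp: positive_def)
    qed
    then have "\<forall>p\<in>set ?P. finite (fst p) \<and> fst p \<noteq> {}" by (auto simp: card_gt_0_iff)
    then show "?P \<in> partitions_of_shape G n \<alpha>"
      using is_word_word[OF u(1)] P by (simp add: partitions_of_shape_def ordered_G_partition_iff)
  qed
qed

lemma finite_compatible_elements: "positive \<alpha> \<Longrightarrow> finite (compatible_elements G n \<alpha>)"
  using bij_betw_finite[OF bij_betw_arrangement] finite_partitions_of_shape by blast

lemma arrange_orbit_sum:
  assumes "positive \<alpha>"
  shows "arrange G n (\<Sum>P\<in>partitions_of_shape G n \<alpha>. frag_of P) =
    (\<Sum>u\<in>compatible_elements G n \<alpha>. frag_of u)"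
  using sum.reindex_bij_betw[OF bij_betw_arrangement[OF assms], of frag_of]
  by (simp add: arrange_def frag_extend_sum[OF finite_partitions_of_shape] comp_def)

text \<open>
  By \<open>runs_cong\<close>, the elements compatible with \<open>\<alpha>\<close> form a union of fibres of
  \<^const>\<open>Co\<close>. By \<open>length_Co_less\<close>, all of these fibres but that of \<open>\<alpha>\<close> belong to compositions
  shorter than \<open>\<alpha>\<close>; this is the triangularity on which bijectivity rests.
\<close>

lemma sum_compatible_elements_eq_sum_Y:
  assumes "positive \<alpha>"
  shows "(\<Sum>u\<in>compatible_elements G n \<alpha>. frag_of u) =
    (\<Sum>\<beta>\<in>Co G n ` compatible_elements G n \<alpha>. Y G n \<beta>)"
proof -
  have "Y G n \<beta> = (\<Sum>u\<in>{u \<in> compatible_elements G n \<alpha>. Co G n u = \<beta>}. frag_of u)"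
    if "\<beta> \<in> Co G n ` compatible_elements G n \<alpha>" for \<beta>
  proof -
    from that obtain v where v: "v \<in> compatible_elements G n \<alpha>" "\<beta> = Co G n v" by blast
    have "{u. u \<in> carrier (wreath_product G n) \<and> Co G n u = \<beta>} =
        {u \<in> compatible_elements G n \<alpha>. Co G n u = \<beta>}"
      using v assms runs_cong[of "word n v" _ \<alpha>]
      by (auto simp: compatible_elements_def Co_eq_run_shape)
    then show ?thesis by (simp add: Y_def)
  qed
  then have "(\<Sum>\<beta>\<in>Co G n ` compatible_elements G n \<alpha>. Y G n \<beta>) =
      (\<Sum>\<beta>\<in>Co G n ` compatible_elements G n \<alpha>.
        \<Sum>u\<in>{u \<in> compatible_elements G n \<alpha>. Co G n u = \<beta>}. frag_of u)"
    by (rule sum.cong[OF refl])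
  also have "\<dots> = (\<Sum>u\<in>compatible_elements G n \<alpha>. frag_of u)"
    using finite_compatible_elements[OF assms] by (intro sum.group) auto
  finally show ?thesis by simp
qed

lemma length_Co_less:
  assumes "positive \<alpha>" "u \<in> compatible_elements G n \<alpha>" "Co G n u \<noteq> \<alpha>"
  shows "length (Co G n u) < length \<alpha>"
  using assms run_shape_minimal[of "word n u" \<alpha>]
  by (auto simp: compatible_elements_def Co_eq_run_shape)

section \<open>The invariant algebra and its anti-homomorphism\<close>

lemma mem_invariant_algebra:
  "x \<in> carrier (invariant_algebra G n) \<longleftrightarrow>
     Poly_Mapping.keys x \<subseteq> {P. ordered_G_partition G n P} \<and>
     (\<forall>\<sigma>. \<sigma> permutes {1..n} \<longrightarrow> frag_extend (\<lambda>P. frag_of (perm_act \<sigma> P)) x = x)"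
  by (auto simp: invariant_algebra_def semigroup_algebra_def sym_group_def)

lemma perm_act_inv:
  assumes "\<sigma> permutes {1..n}"
  shows "perm_act (inv_into UNIV \<sigma>) (perm_act \<sigma> P) = P" "perm_act \<sigma> (perm_act (inv_into UNIV \<sigma>) P) = P"
  using permutes_inv_o[OF assms] by (auto simp: perm_act_def image_comp intro!: map_idI)

lemma shape_perm_act: "\<sigma> permutes {1..n} \<Longrightarrow> shape (perm_act \<sigma> P) = shape P"
  by (auto simp: shape_def perm_act_def card_image inj_on_subset[OF permutes_inj])

lemma orbit_sum_invariant:
  "(\<Sum>P\<in>partitions_of_shape G n \<alpha>. frag_of P) \<in> carrier (invariant_algebra G n)"
  unfolding mem_invariant_algebra
proof (intro conjI allI impI)
  show "Poly_Mapping.keys (\<Sum>P\<in>partitions_of_shape G n \<alpha>. frag_of P) \<subseteq> {P. ordered_G_partition G n P}"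
    using keys_sum[of frag_of "partitions_of_shape G n \<alpha>"] by (auto simp: partitions_of_shape_def)
  fix \<sigma> assume \<sigma>: "\<sigma> permutes {1..n}"
  have "bij_betw (perm_act \<sigma>) (partitions_of_shape G n \<alpha>) (partitions_of_shape G n \<alpha>)"
    by (rule bij_betw_byWitness[where f' = "perm_act (inv_into UNIV \<sigma>)"])
      (auto simp: partitions_of_shape_def perm_act_inv[OF \<sigma>] shape_perm_act[OF \<sigma>]
        shape_perm_act[OF permutes_inv[OF \<sigma>]] intro: perm_act_closed \<sigma> permutes_inv)
  from sum.reindex_bij_betw[OF this, of frag_of]
  show "frag_extend (\<lambda>P. frag_of (perm_act \<sigma> P)) (\<Sum>P\<in>partitions_of_shape G n \<alpha>. frag_of P) =
      (\<Sum>P\<in>partitions_of_shape G n \<alpha>. frag_of P)"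
    by (simp add: frag_extend_sum[OF finite_partitions_of_shape] comp_def)
qed

lemma lookup_invariant_eq:
  assumes "x \<in> carrier (invariant_algebra G n)"
    and "ordered_G_partition G n P" "ordered_G_partition G n Q" "shape P = shape Q"
  shows "Poly_Mapping.lookup x P = Poly_Mapping.lookup x Q"
proof -
  obtain \<sigma> where \<sigma>: "\<sigma> permutes {1..n}" "perm_act \<sigma> P = Q"
    using same_shape_imp_perm_act[OF assms(2-4)] .
  have "inj (perm_act \<sigma> :: (nat set \<times> 'a) list \<Rightarrow> _)"
    by (rule inj_on_inverseI[where g = "perm_act (inv_into UNIV \<sigma>)"]) (simp add: perm_act_inv[OF \<sigma>(1)])
  from lookup_frag_extend_inj[OF this, of x P] show ?thesis
    using assms(1) \<sigma> by (simp add: mem_invariant_algebra)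
qed

text \<open>
  The orbits are the sets of partitions of equal shape, and an invariant element has constant
  coefficients on each of them. The group may be infinite, but every orbit and every support is
  finite.
\<close>

lemma invariant_eq_sum_orbit_sums:
  assumes "x \<in> carrier (invariant_algebra G n)"
  obtains c where "\<forall>P\<in>Poly_Mapping.keys x. c (shape P) \<noteq> 0"
    and "x = (\<Sum>\<alpha>\<in>shape ` Poly_Mapping.keys x.
      frag_cmul (c \<alpha>) (\<Sum>P\<in>partitions_of_shape G n \<alpha>. frag_of P))"
proof -
  define c where "c \<alpha> = Poly_Mapping.lookup x (SOME P. P \<in> partitions_of_shape G n \<alpha>)" for \<alpha>
  have c: "c (shape P) = Poly_Mapping.lookup x P" if "ordered_G_partition G n P" for P
  proof -
    let ?Q = "SOME Q. Q \<in> partitions_of_shape G n (shape P)"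
    have "?Q \<in> partitions_of_shape G n (shape P)"
      by (rule someI[of _ P]) (simp add: partitions_of_shape_def that)
    then have "ordered_G_partition G n ?Q" "shape ?Q = shape P"
      by (simp_all add: partitions_of_shape_def)
    then show ?thesis unfolding c_def by (rule lookup_invariant_eq[OF assms _ that])
  qed
  have keys: "ordered_G_partition G n P" if "P \<in> Poly_Mapping.keys x" for P
    using assms that by (auto simp: mem_invariant_algebra)
  have "x = (\<Sum>\<alpha>\<in>shape ` Poly_Mapping.keys x.
      frag_cmul (c \<alpha>) (\<Sum>P\<in>partitions_of_shape G n \<alpha>. frag_of P))" (is "_ = ?r")
  proof (rule poly_mapping_eqI)
    fix P
    have "Poly_Mapping.lookup ?r P = (\<Sum>\<alpha>\<in>shape ` Poly_Mapping.keys x.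
        if ordered_G_partition G n P \<and> \<alpha> = shape P then c \<alpha> else 0)"
      by (subst lookup_sum_cmul_sum_frag_of)
        (auto simp: finite_partitions_of_shape, auto simp: partitions_of_shape_def intro!: sum.cong)
    also have "\<dots> = (if ordered_G_partition G n P \<and> shape P \<in> shape ` Poly_Mapping.keys x
        then c (shape P) else 0)"
      by (cases "ordered_G_partition G n P") simp_all
    also have "\<dots> = Poly_Mapping.lookup x P"
      using c keys by (auto simp: in_keys_iff)
    finally show "Poly_Mapping.lookup x P = Poly_Mapping.lookup ?r P" by simp
  qed
  moreover have "\<forall>P\<in>Poly_Mapping.keys x. c (shape P) \<noteq> 0"
    using c keys by (simp add: in_keys_iff)
  ultimately show ?thesis by (rule that[rotated])
qed

lemma mult_semigroup_algebra:
  "x \<otimes>\<^bsub>semigroup_algebra M\<^esub> y = frag_extend (\<lambda>a. frag_extend (\<lambda>b. frag_of (a \<otimes>\<^bsub>M\<^esub> b)) y) x"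
  by (simp add: semigroup_algebra_def)

lemma invariant_mult_closed:
  assumes "group G" "x \<in> carrier (invariant_algebra G n)" "y \<in> carrier (invariant_algebra G n)"
  shows "x \<otimes>\<^bsub>semigroup_algebra (G_partition_monoid G n)\<^esub> y \<in> carrier (invariant_algebra G n)"
  unfolding mem_invariant_algebra mult_semigroup_algebra
proof (intro conjI allI impI)
  have "Poly_Mapping.keys (frag_extend (\<lambda>b. frag_of (a \<otimes>\<^bsub>G_partition_monoid G n\<^esub> b)) y)
      \<subseteq> {P. ordered_G_partition G n P}" if "a \<in> Poly_Mapping.keys x" for a
    using assms that G_partition_mult(1)[OF assms(1)]
    by (intro order_trans[OF keys_frag_extend]) (auto simp: mem_invariant_algebra subset_iff)
  then show "Poly_Mapping.keys (frag_extend (\<lambda>a. frag_extend (\<lambda>b. frag_of (a \<otimes>\<^bsub>G_partition_monoid G n\<^esub> b)) y) x)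
      \<subseteq> {P. ordered_G_partition G n P}"
    by (intro order_trans[OF keys_frag_extend]) auto
  fix \<sigma> assume \<sigma>: "\<sigma> permutes {1..n}"
  have x: "frag_extend (\<lambda>P. frag_of (perm_act \<sigma> P)) x = x"
    and y: "frag_extend (\<lambda>P. frag_of (perm_act \<sigma> P)) y = y"
    using assms \<sigma> by (auto simp: mem_invariant_algebra)
  have "frag_extend (\<lambda>P. frag_of (perm_act \<sigma> P))
        (frag_extend (\<lambda>a. frag_extend (\<lambda>b. frag_of (a \<otimes>\<^bsub>G_partition_monoid G n\<^esub> b)) y) x) =
      frag_extend (\<lambda>a. frag_extend (\<lambda>b. frag_of
        (perm_act \<sigma> a \<otimes>\<^bsub>G_partition_monoid G n\<^esub> perm_act \<sigma> b)) y) x"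
    by (simp add: frag_extend_frag_extend perm_act_mult[OF permutes_inj[OF \<sigma>]])
  also have "\<dots> = frag_extend (\<lambda>a. frag_extend (\<lambda>b. frag_of (a \<otimes>\<^bsub>G_partition_monoid G n\<^esub> b))
      (frag_extend (\<lambda>P. frag_of (perm_act \<sigma> P)) y)) (frag_extend (\<lambda>P. frag_of (perm_act \<sigma> P)) x)"
    by (simp add: frag_extend_frag_extend)
  finally show "frag_extend (\<lambda>P. frag_of (perm_act \<sigma> P))
        (frag_extend (\<lambda>a. frag_extend (\<lambda>b. frag_of (a \<otimes>\<^bsub>G_partition_monoid G n\<^esub> b)) y) x) =
      frag_extend (\<lambda>a. frag_extend (\<lambda>b. frag_of (a \<otimes>\<^bsub>G_partition_monoid G n\<^esub> b)) y) x"
    by (simp only: x y)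
qed

text \<open>
  On basis elements the right factor of \<open>listing_mult_eq_word\<close> is a translate of \<open>P\<close> that depends
  on \<open>Q\<close>. Summed over an invariant \<open>x\<close>, the translates make up \<open>x\<close> again, and the dependence
  disappears.
\<close>

lemma arrange_mult:
  assumes "group G" "x \<in> carrier (invariant_algebra G n)" "y \<in> carrier (invariant_algebra G n)"
  shows "arrange G n (x \<otimes>\<^bsub>semigroup_algebra (G_partition_monoid G n)\<^esub> y) =
    arrange G n y \<otimes>\<^bsub>semigroup_algebra (wreath_product G n)\<^esub> arrange G n x"
proof -
  let ?a = "arrangement G n"
  have inner: "frag_extend (\<lambda>P. frag_of (?a (P \<otimes>\<^bsub>G_partition_monoid G n\<^esub> Q))) x =
      frag_extend (\<lambda>v. frag_of (?a Q \<otimes>\<^bsub>wreath_product G n\<^esub> v)) (arrange G n x)"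
    if "Q \<in> Poly_Mapping.keys y" for Q
  proof -
    let ?\<sigma> = "inv_into UNIV (fst (?a Q))"
    have Q: "ordered_G_partition G n Q" using that assms(3) by (auto simp: mem_invariant_algebra)
    then have "?\<sigma> permutes {1..n}"
      using arrangement(1)[of G n Q] by (auto simp: carrier_wreath_product intro: permutes_inv)
    then have inv: "frag_extend (\<lambda>P. frag_of (perm_act ?\<sigma> P)) x = x"
      using assms(2) by (simp add: mem_invariant_algebra)
    have "frag_extend (\<lambda>P. frag_of (?a (P \<otimes>\<^bsub>G_partition_monoid G n\<^esub> Q))) x =
        frag_extend (\<lambda>P. frag_of (?a Q \<otimes>\<^bsub>wreath_product G n\<^esub> ?a (perm_act ?\<sigma> P))) x"
      using assms(2) G_partition_mult(2)[OF assms(1) _ Q]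
      by (intro frag_extend_eq) (auto simp: mem_invariant_algebra)
    also have "\<dots> = frag_extend (\<lambda>P. frag_of (?a Q \<otimes>\<^bsub>wreath_product G n\<^esub> ?a P))
        (frag_extend (\<lambda>P. frag_of (perm_act ?\<sigma> P)) x)"
      by (simp add: frag_extend_frag_extend)
    also have "\<dots> = frag_extend (\<lambda>v. frag_of (?a Q \<otimes>\<^bsub>wreath_product G n\<^esub> v)) (arrange G n x)"
      unfolding inv by (simp add: arrange_def frag_extend_frag_extend)
    finally show ?thesis .
  qed
  have "arrange G n (x \<otimes>\<^bsub>semigroup_algebra (G_partition_monoid G n)\<^esub> y) =
      frag_extend (\<lambda>Q. frag_extend (\<lambda>P. frag_of (?a (P \<otimes>\<^bsub>G_partition_monoid G n\<^esub> Q))) x) y"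
    by (subst frag_extend_swap)
      (simp add: mult_semigroup_algebra arrange_def frag_extend_frag_extend)
  also have "\<dots> = frag_extend (\<lambda>Q. frag_extend (\<lambda>v. frag_of (?a Q \<otimes>\<^bsub>wreath_product G n\<^esub> v))
      (arrange G n x)) y"
    by (rule frag_extend_eq) (rule inner)
  also have "\<dots> = arrange G n y \<otimes>\<^bsub>semigroup_algebra (wreath_product G n)\<^esub> arrange G n x"
    by (simp add: mult_semigroup_algebra arrange_def[of G n] frag_extend_frag_extend)
  finally show ?thesis .
qed

lemma invariant_linear:
  assumes "x \<in> carrier (invariant_algebra G n)" "y \<in> carrier (invariant_algebra G n)"
  shows "x + y \<in> carrier (invariant_algebra G n)" "frag_cmul k x \<in> carrier (invariant_algebra G n)"
  using assms keys_add[of x y] by (auto simp: mem_invariant_algebra frag_extend_add frag_extend_cmul)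

lemma zero_invariant: "0 \<in> carrier (invariant_algebra G n)"
  by (simp add: mem_invariant_algebra)

lemma one_invariant:
  assumes "group G" "n > 0"
  shows "frag_of \<one>\<^bsub>G_partition_monoid G n\<^esub> \<in> carrier (invariant_algebra G n)"
  using arrangement_one(1)[OF assms] by (auto simp: mem_invariant_algebra perm_act_one)

section \<open>Triangularity and the anti-isomorphism\<close>

lemma arrange_linear:
  "arrange G n (x + y) = arrange G n x + arrange G n y"
  "arrange G n (frag_cmul k x) = frag_cmul k (arrange G n x)"
  "arrange G n 0 = 0"
  "arrange G n (x - y) = arrange G n x - arrange G n y"
  by (simp_all add: arrange_def frag_extend_add frag_extend_cmul frag_extend_diff)

lemma arrange_sum_orbit_sums:
  assumes "finite A" "\<forall>\<alpha>\<in>A. positive \<alpha>"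
  shows "arrange G n (\<Sum>\<alpha>\<in>A. frag_cmul (c \<alpha>) (\<Sum>P\<in>partitions_of_shape G n \<alpha>. frag_of P)) =
    (\<Sum>\<alpha>\<in>A. frag_cmul (c \<alpha>) (\<Sum>u\<in>compatible_elements G n \<alpha>. frag_of u))"
  using assms
  by (induction A rule: finite_induct) (simp_all add: arrange_linear arrange_orbit_sum)

text \<open>
  Among the shapes in the support of a nonzero invariant, take one, \<open>\<alpha>\<close>, of maximal length. An
  element \<open>u\<close> with composition \<open>\<alpha>\<close> is compatible only with \<open>\<alpha>\<close> and with longer
  compositions, so its coefficient in the image is the coefficient of the orbit of shape \<open>\<alpha>\<close>.
\<close>

lemma arrange_eq_0:
  assumes "x \<in> carrier (invariant_algebra G n)" "arrange G n x = 0"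
  shows "x = 0"
proof (rule ccontr)
  assume "x \<noteq> 0"
  define A where "A = shape ` Poly_Mapping.keys x"
  obtain c where c: "\<forall>P\<in>Poly_Mapping.keys x. c (shape P) \<noteq> 0"
      and x: "x = (\<Sum>\<alpha>\<in>A. frag_cmul (c \<alpha>) (\<Sum>P\<in>partitions_of_shape G n \<alpha>. frag_of P))"
    unfolding A_def by (rule invariant_eq_sum_orbit_sums[OF assms(1)])
  have A: "finite A" "A \<noteq> {}" using \<open>x \<noteq> 0\<close> by (auto simp: A_def)
  have comp: "G_composition G n \<alpha>" if "\<alpha> \<in> A" for \<alpha>
    using that assms(1) G_composition_shape by (auto simp: A_def mem_invariant_algebra)
  then have pos: "positive \<alpha>" if "\<alpha> \<in> A" for \<alpha>
    using that by (auto simp: G_composition_iff_positive)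
  \<comment> \<open>Maximal length leaves only \<open>\<alpha>\<close> itself among the shapes compatible with \<open>u\<close>.\<close>
  obtain \<alpha> where \<alpha>: "\<alpha> \<in> A" and max: "\<And>\<beta>. \<beta> \<in> A \<Longrightarrow> length \<beta> \<le> length \<alpha>"
  proof -
    have "Max (length ` A) \<in> length ` A" using A by (intro Max_in) auto
    then obtain \<alpha> where "\<alpha> \<in> A" "Max (length ` A) = length \<alpha>" by blast
    then show ?thesis using that A(1) by (metis Max_ge finite_imageI image_eqI)
  qed
  obtain u where u: "u \<in> carrier (wreath_product G n)" "Co G n u = \<alpha>"
    using exists_Co_eq comp[OF \<alpha>] by blast
  have "runs (word n u) \<alpha>" using u runs_run_shape by (metis Co_eq_run_shape)
  then have mem: "u \<in> compatible_elements G n \<beta> \<longleftrightarrow> \<beta> = \<alpha>" if "\<beta> \<in> A" for \<beta>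
    using u length_Co_less[OF pos[OF that], of u G n] max[OF that]
    by (auto simp: compatible_elements_def)
  have "Poly_Mapping.lookup (arrange G n x) u =
      (\<Sum>\<beta>\<in>A. if u \<in> compatible_elements G n \<beta> then c \<beta> else 0)"
    by (subst x) (simp add: arrange_sum_orbit_sums A pos lookup_sum_cmul_sum_frag_of
        finite_compatible_elements)
  also have "\<dots> = (\<Sum>\<beta>\<in>A. if \<beta> = \<alpha> then c \<beta> else 0)"
    by (rule sum.cong) (auto simp: mem)
  also have "\<dots> = c \<alpha>" using A(1) \<alpha> by simp
  finally show False using assms(2) c \<alpha> by (auto simp: A_def)
qed

lemma inj_on_arrange: "inj_on (arrange G n) (carrier (invariant_algebra G n))"
proof (rule inj_onI)
  fix x y assume xy: "x \<in> carrier (invariant_algebra G n)" "y \<in> carrier (invariant_algebra G n)"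
    "arrange G n x = arrange G n y"
  have "x + frag_cmul (-1) y \<in> carrier (invariant_algebra G n)"
    using xy by (intro invariant_linear)
  moreover have "arrange G n (x + frag_cmul (-1) y) = 0"
    using xy(3) by (simp add: arrange_linear del: minus_frag_cmul)
  ultimately have "x + frag_cmul (-1) y = 0" by (rule arrange_eq_0)
  then show "x = y" by simp
qed

lemma subspace_image_arrange:
  "Modules.module.subspace frag_cmul (arrange G n ` carrier (invariant_algebra G n))"
proof -
  let ?I = "arrange G n ` carrier (invariant_algebra G n)"
  have "0 \<in> ?I" by (rule image_eqI[OF _ zero_invariant]) (simp add: arrange_linear)
  moreover have "arrange G n a + arrange G n b \<in> ?I" "frag_cmul k (arrange G n a) \<in> ?I"
    if "a \<in> carrier (invariant_algebra G n)" "b \<in> carrier (invariant_algebra G n)" for a b k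
    using invariant_linear[OF that] by (simp_all flip: arrange_linear)
  ultimately show ?thesis
    unfolding module.subspace_def[OF module_frag_cmul] by blast
qed

text \<open>
  The image of the orbit sum of shape \<open>\<alpha>\<close> is \<open>Y G n \<alpha>\<close> plus terms \<open>Y G n \<beta>\<close> with shorter \<open>\<beta>\<close>,
  so the induction is on the length.
\<close>

lemma Y_in_image:
  assumes "G_composition G n \<alpha>"
  shows "Y G n \<alpha> \<in> arrange G n ` carrier (invariant_algebra G n)"
  using assms
proof (induction "length \<alpha>" arbitrary: \<alpha> rule: less_induct)
  case less
  let ?I = "arrange G n ` carrier (invariant_algebra G n)"
  let ?C = "Co G n ` compatible_elements G n \<alpha>"
  have pos: "positive \<alpha>" using less.prems by (simp add: G_composition_iff_positive)
  have fin: "finite ?C" using finite_compatible_elements[OF pos, of G n] by simp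
  have sub: "Modules.module.subspace frag_cmul ?I" by (rule subspace_image_arrange)
  obtain u where u: "u \<in> carrier (wreath_product G n)" "Co G n u = \<alpha>"
    using exists_Co_eq less.prems by blast
  then have "runs (word n u) \<alpha>" using runs_run_shape by (metis Co_eq_run_shape)
  then have "\<alpha> \<in> ?C" using u by (auto simp: compatible_elements_def)
  then have "(\<Sum>u\<in>compatible_elements G n \<alpha>. frag_of u) = Y G n \<alpha> + (\<Sum>\<beta>\<in>?C - {\<alpha>}. Y G n \<beta>)"
    using fin by (simp add: sum_compatible_elements_eq_sum_Y[OF pos] sum.remove)
  then have "Y G n \<alpha> = (\<Sum>u\<in>compatible_elements G n \<alpha>. frag_of u) - (\<Sum>\<beta>\<in>?C - {\<alpha>}. Y G n \<beta>)"
    by simp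
  moreover have "(\<Sum>u\<in>compatible_elements G n \<alpha>. frag_of u) \<in> ?I"
    using arrange_orbit_sum[OF pos] orbit_sum_invariant by (metis imageI)
  moreover have "(\<Sum>\<beta>\<in>?C - {\<alpha>}. Y G n \<beta>) \<in> ?I"
  proof (rule module.subspace_sum[OF module_frag_cmul sub])
    fix \<beta> assume "\<beta> \<in> ?C - {\<alpha>}"
    then obtain v where v: "v \<in> compatible_elements G n \<alpha>" "\<beta> = Co G n v" "\<beta> \<noteq> \<alpha>" by blast
    then have "length \<beta> < length \<alpha>" using length_Co_less[OF pos] by blast
    moreover have "G_composition G n \<beta>"
      using v G_composition_Co[of v G n] by (auto simp: compatible_elements_def)
    ultimately show "Y G n \<beta> \<in> ?I" by (rule less.hyps)
  qed
  ultimately show ?case using module.subspace_diff[OF module_frag_cmul sub] by simp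
qed

lemma image_arrange_eq_descent_module:
  "arrange G n ` carrier (invariant_algebra G n) = descent_module G n"
proof
  let ?I = "arrange G n ` carrier (invariant_algebra G n)"
  have "Modules.module.subspace frag_cmul ?I" by (rule subspace_image_arrange)
  moreover have "{Y G n \<alpha> |\<alpha>. G_composition G n \<alpha>} \<subseteq> ?I" using Y_in_image by blast
  ultimately show "descent_module G n \<subseteq> ?I"
    unfolding descent_module_def by (intro module.span_minimal[OF module_frag_cmul])
  show "?I \<subseteq> descent_module G n"
  proof (rule image_subsetI)
    fix x assume x: "x \<in> carrier (invariant_algebra G n)"
    define A where "A = shape ` Poly_Mapping.keys x"
    obtain c where eq: "x = (\<Sum>\<alpha>\<in>A. frag_cmul (c \<alpha>) (\<Sum>P\<in>partitions_of_shape G n \<alpha>. frag_of P))"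
      unfolding A_def using invariant_eq_sum_orbit_sums[OF x] by blast
    have fin: "finite A" by (simp add: A_def)
    have pos: "positive \<alpha>" if "\<alpha> \<in> A" for \<alpha>
      using that x G_composition_shape
      by (fastforce simp: A_def mem_invariant_algebra G_composition_iff_positive)
    have "arrange G n x = (\<Sum>\<alpha>\<in>A. frag_cmul (c \<alpha>) (\<Sum>\<beta>\<in>Co G n ` compatible_elements G n \<alpha>. Y G n \<beta>))"
      by (subst eq) (simp add: arrange_sum_orbit_sums fin pos
          sum_compatible_elements_eq_sum_Y)
    also have "\<dots> \<in> descent_module G n"
      unfolding descent_module_def
      by (intro module.span_sum[OF module_frag_cmul] module.span_scale[OF module_frag_cmul]
          module.span_base[OF module_frag_cmul])
        (auto simp: compatible_elements_def intro: G_composition_Co)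
    finally show "arrange G n x \<in> descent_module G n" .
  qed
qed

theorem corollary4:
  fixes G :: "('g, 'm) monoid_scheme" and n :: nat
  assumes "group G" and "n > 0"
  shows "subalgebra_over \<Z> (descent_module G n) (semigroup_algebra (wreath_product G n)) \<and>
         anti_isomorphic \<Z>
           ((semigroup_algebra (wreath_product G n))\<lparr>carrier := descent_module G n\<rparr>)
           (invariant_algebra G n)"
proof
  let ?A = "semigroup_algebra (wreath_product G n)"
  let ?D = "descent_module G n"
  let ?I = "carrier (invariant_algebra G n)"
  let ?F = "arrange G n"
  have bij: "bij_betw ?F ?I ?D"
    using inj_on_arrange image_arrange_eq_descent_module by (rule bij_betw_imageI)
  have D: "\<exists>y\<in>?I. x = ?F y" if "x \<in> ?D" for x
    using that image_arrange_eq_descent_module[of G n] by blast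
  have FD: "?F y \<in> ?D" if "y \<in> ?I" for y
    using that image_arrange_eq_descent_module[of G n] by blast
  have keys: "Poly_Mapping.keys x \<subseteq> carrier (wreath_product G n)" if "x \<in> ?D" for x
  proof -
    from that obtain y where "y \<in> ?I" "x = ?F y" using D by blast
    then show ?thesis
      using keys_frag_extend[of "\<lambda>P. frag_of (arrangement G n P)" y] arrangement(1)
      by (fastforce simp: arrange_def mem_invariant_algebra)
  qed
  have add: "x + y \<in> ?D" and cmul: "frag_cmul k x \<in> ?D" and mult: "x \<otimes>\<^bsub>?A\<^esub> y \<in> ?D"
    if xy: "x \<in> ?D" "y \<in> ?D" for x y k
  proof -
    obtain a b where ab: "a \<in> ?I" "b \<in> ?I" "x = ?F a" "y = ?F b" using D xy by metis
    show "x + y \<in> ?D" "frag_cmul k x \<in> ?D"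
      using FD invariant_linear[OF ab(1,2)] by (simp_all add: ab flip: arrange_linear)
    show "x \<otimes>\<^bsub>?A\<^esub> y \<in> ?D"
      using FD[OF invariant_mult_closed[OF assms(1) ab(2,1)]] arrange_mult[OF assms(1) ab(2,1)]
      by (simp add: ab)
  qed
  have zero: "0 \<in> ?D" using FD[OF zero_invariant] by (simp add: arrange_linear)
  have one: "\<one>\<^bsub>?A\<^esub> \<in> ?D"
    using FD[OF one_invariant[OF assms]] arrangement_one(2)[OF assms]
    by (simp add: arrange_def semigroup_algebra_def)
  \<comment> \<open>The inverse in the additive monoid is a definite description, to be identified with \<open>-\<close>.\<close>
  have neg: "inv\<^bsub>add_monoid ?A\<^esub> x = - x" if "x \<in> carrier ?A" for x
    unfolding m_inv_def
    by (rule the_equality) (use that in \<open>auto simp: semigroup_algebra_def eq_neg_iff_add_eq_0\<close>)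
  have "- x \<in> ?D" if "x \<in> ?D" for x using cmul[OF that that, of "-1"] by simp
  then have "subgroup ?D (add_monoid ?A)"
    using keys add zero neg
    by (intro subgroup.intro) (auto simp: semigroup_algebra_def)
  moreover have "submonoid ?D ?A"
    using keys mult one by (intro submonoid.intro) (auto simp: semigroup_algebra_def)
  ultimately show "subalgebra_over \<Z> ?D ?A"
    unfolding subalgebra_over_def
    by (intro conjI submodule.intro subring.intro submodule_axioms.intro)
      (auto simp: semigroup_algebra_def cmul)
  show "anti_isomorphic \<Z> (?A\<lparr>carrier := ?D\<rparr>) (invariant_algebra G n)"
    unfolding anti_isomorphic_def
  proof (intro exI[of _ "inv_into ?I ?F"] conjI ballI)
    let ?f = "inv_into ?I ?F"
    show "bij_betw ?f (carrier (?A\<lparr>carrier := ?D\<rparr>)) ?I"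
      using bij_betw_inv_into[OF bij] by simp
    have f: "?f (?F a) = a" if "a \<in> ?I" for a using bij_betw_inv_into_left[OF bij that] .
    {
      fix x y assume "x \<in> carrier (?A\<lparr>carrier := ?D\<rparr>)" "y \<in> carrier (?A\<lparr>carrier := ?D\<rparr>)"
      then have "x \<in> ?D" "y \<in> ?D" by simp_all
      then obtain a b where ab: "a \<in> ?I" "b \<in> ?I" "x = ?F a" "y = ?F b" using D by metis
      show "?f (x \<oplus>\<^bsub>?A\<lparr>carrier := ?D\<rparr>\<^esub> y) = ?f x \<oplus>\<^bsub>invariant_algebra G n\<^esub> ?f y"
        using f[OF invariant_linear(1)[OF ab(1,2)]] f ab
        by (simp add: semigroup_algebra_def invariant_algebra_def arrange_linear)
      show "?f (x \<otimes>\<^bsub>?A\<lparr>carrier := ?D\<rparr>\<^esub> y) = ?f y \<otimes>\<^bsub>invariant_algebra G n\<^esub> ?f x"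
        using f[OF invariant_mult_closed[OF assms(1) ab(2,1)]] f ab arrange_mult[OF assms(1) ab(2,1)]
        by (simp add: invariant_algebra_def)
    }
    fix k x assume "x \<in> carrier (?A\<lparr>carrier := ?D\<rparr>)"
    then have "x \<in> ?D" by simp
    then obtain a where a: "a \<in> ?I" "x = ?F a" using D by metis
    show "?f (k \<odot>\<^bsub>?A\<lparr>carrier := ?D\<rparr>\<^esub> x) = k \<odot>\<^bsub>invariant_algebra G n\<^esub> ?f x"
      using f[OF invariant_linear(2)[OF a(1) a(1), of k]] f a
      by (simp add: semigroup_algebra_def invariant_algebra_def arrange_linear)
  qed
qed

end
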